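(* Let $\mathcal M$ be a type $\mathrm{II}_1$ factor, let $|\!|\!|\cdot|\!|\!|$ be a unitarily invariant norm on $\mathcal M$ and let $\mathcal T$ be the topology induced by $|\!|\!|\cdot|\!|\!|$ on $\mathcal M_{1,\|\cdot\|}=\{T\in\mathcal M:\ \|T\|\le1\}$. If $|\!|\!|\cdot|\!|\!|$ is singular, then $\mathcal T$ is the operator norm topology on $\mathcal M_{1,\|\cdot\|}$. If $|\!|\!|\cdot|\!|\!|$ is continuous, then $\mathcal T$ is the measure topology (in the sense of Nelson) on $\mathcal M_{1,\|\cdot\|}$.
   Context: $\|\cdot\|$ is the operator norm and $\tau$ is the unique tracial state of $\mathcal M$. A norm on $\mathcal M$ is unitarily invariant if $|\!|\!|UTV|\!|\!|=|\!|\!|T|\!|\!|$ for all $T\in\mathcal M$ and unitaries $U,V\in\mathcal M$. For such a norm $|\!|\!|E|\!|\!|\le|\!|\!|F|\!|\!|$ whenever $E,F$ are projections with $\tau(E)\le\tau(F)$, so $\lim_{\tau(E)\to0+}|\!|\!|E|\!|\!|$ (over nonzero projections $E\in\mathcal M$) exists; the norm is singular if this limit is $>0$ and continuous if it is $=0$. The measure topology on $\mathcal M$ is the translation-invariant topology for which the sets $N(\epsilon,\delta)=\{T\in\mathcal M:\ \text{there is a projection }E\in\mathcal M\text{ with }\tau(E)<\delta\text{ and }\|T(1-E)\|<\epsilon\}$, $\epsilon,\delta>0$, form a base of neighborhoods of $0$. *)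

theory Defs
  imports "HOL-Analysis.Analysis"
begin

section \<open>Complex Hilbert spaces\<close>

text \<open>
  A complex Hilbert space is a real Hilbert space with a compatible complex scalar multiplication
  and a complex inner product, linear in the first argument, whose real part is the given real
  inner product. Norm and topology are therefore those of the real structure.
\<close>

class chilbert_space = real_inner + complete_space +
  fixes scaleC :: "complex \<Rightarrow> 'a \<Rightarrow> 'a" (infixr \<open>*\<^sub>C\<close> 75)
    and cinner :: "'a \<Rightarrow> 'a \<Rightarrow> complex"
  assumes scaleC_add_right: "a *\<^sub>C (x + y) = a *\<^sub>C x + a *\<^sub>C y"
    and scaleC_add_left: "(a + b) *\<^sub>C x = a *\<^sub>C x + b *\<^sub>C x"
    and scaleC_scaleC: "a *\<^sub>C b *\<^sub>C x = (a * b) *\<^sub>C x"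
    and scaleC_of_real: "complex_of_real r *\<^sub>C x = r *\<^sub>R x"
    and cinner_commute: "cinner x y = cnj (cinner y x)"
    and cinner_add_left: "cinner (x + y) z = cinner x z + cinner y z"
    and cinner_scaleC_left: "cinner (a *\<^sub>C x) y = a * cinner x y"
    and Re_cinner: "Re (cinner x y) = inner x y"
begin

lemma cinner_add_right: "cinner x (y + z) = cinner x y + cinner x z"
  by (metis cinner_add_left cinner_commute complex_cnj_add)

lemma cinner_scaleC_right: "cinner x (a *\<^sub>C y) = cnj a * cinner x y"
  by (metis cinner_commute cinner_scaleC_left complex_cnj_mult)

lemma cinner_self: "cinner x x = complex_of_real ((norm x)\<^sup>2)"
proof -
  have "Im (cinner x x) = 0"
    using cinner_commute[of x x] by (metis complex_cnj_cancel_iff Reals_cnj_iff complex_is_Real_iff)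
  moreover have "Re (cinner x x) = (norm x)\<^sup>2"
    by (simp add: Re_cinner norm_eq_sqrt_inner)
  ultimately show ?thesis
    by (simp add: complex_eq_iff)
qed

lemma Im_cinner: "Im (cinner x y) = inner ((- \<i>) *\<^sub>C x) y"
  by (simp flip: Re_cinner add: cinner_scaleC_left)

lemma norm_scaleC: "norm (a *\<^sub>C x) = cmod a * norm x"
proof -
  have "complex_of_real ((norm (a *\<^sub>C x))\<^sup>2) = complex_of_real ((cmod a * norm x)\<^sup>2)"
    unfolding cinner_self[symmetric] cinner_scaleC_left cinner_scaleC_right
    by (simp only: cinner_self power_mult_distrib of_real_mult complex_norm_square[of a]
        mult.assoc mult.left_commute)
  then have "(norm (a *\<^sub>C x))\<^sup>2 = (cmod a * norm x)\<^sup>2"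
    using of_real_eq_iff by blast
  then show ?thesis
    by (simp add: norm_eq_sqrt_inner)
qed

end

instantiation complex :: chilbert_space
begin

definition "scaleC_complex (a :: complex) x = a * x"
definition "cinner_complex x (y :: complex) = x * cnj y"

instance
  by standard (auto simp: scaleC_complex_def cinner_complex_def algebra_simps scaleR_conv_of_real
      inner_complex_def)

end


section \<open>Operators on a Hilbert space\<close>

text \<open>
  The type \<open>'h \<Rightarrow>\<^sub>L 'h\<close> consists of the bounded real-linear maps and its norm is the operator norm;
  the algebra of bounded complex-linear operators is the following subset.
\<close>

definition bounded_ops :: "('h::chilbert_space \<Rightarrow>\<^sub>L 'h) set" where
  "bounded_ops = {T. \<forall>c x. blinfun_apply T (c *\<^sub>C x) = c *\<^sub>C blinfun_apply T x}"

lift_definition scale_op :: "complex \<Rightarrow> ('h::chilbert_space \<Rightarrow>\<^sub>L 'h) \<Rightarrow> ('h \<Rightarrow>\<^sub>L 'h)"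
  is "\<lambda>c T x. c *\<^sub>C T x"
proof -
  fix c :: complex and T :: "'h \<Rightarrow> 'h"
  assume T: "bounded_linear T"
  have "bounded_linear (\<lambda>x::'h. c *\<^sub>C x)"
  proof (rule bounded_linear_intro[where K = "cmod c"])
    fix r and x :: 'h
    show "c *\<^sub>C r *\<^sub>R x = r *\<^sub>R c *\<^sub>C x"
      unfolding scaleC_of_real[symmetric] scaleC_scaleC by (simp add: mult.commute)
  qed (auto simp: scaleC_add_right norm_scaleC mult.commute)
  then show "bounded_linear (\<lambda>x. c *\<^sub>C T x)"
    using T by (rule bounded_linear_compose)
qed

definition adj :: "('h::chilbert_space \<Rightarrow>\<^sub>L 'h) \<Rightarrow> ('h \<Rightarrow>\<^sub>L 'h)" where
  "adj T = (THE S. \<forall>x y. cinner (blinfun_apply T x) y = cinner x (blinfun_apply S y))"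

text \<open>The Riesz representation theorem, needed only to see that \<^const>\<open>adj\<close> is well defined.\<close>

lemma riesz_representation:
  fixes g :: "'a::{real_inner, complete_space} \<Rightarrow> real"
  assumes g: "bounded_linear g"
  shows "\<exists>z. \<forall>x. g x = inner x z"
proof -
  interpret g: bounded_linear g by fact
  define J where "J x = (norm x)\<^sup>2 - 2 * g x" for x
  define m where "m = Inf (range J)"
  obtain K where K: "\<And>x. norm (g x) \<le> norm x * K"
    using g.bounded by blast
  have "- K\<^sup>2 \<le> J x" for x
  proof -
    have "g x \<le> norm x * K" using K[of x] by (simp add: abs_le_iff)
    moreover have "0 \<le> (norm x - K)\<^sup>2" by simp
    ultimately show ?thesis by (simp add: J_def power2_diff)
  qed
  then have bdd: "bdd_below (range J)"
    by (auto intro!: bdd_belowI)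
  have m_le: "m \<le> J x" for x
    unfolding m_def by (rule cInf_lower) (auto simp: bdd)
  have "\<exists>x. J x < m + 1 / real (Suc n)" for n
    using cInf_less_iff[of "range J" "m + 1 / real (Suc n)"] bdd by (auto simp: m_def)
  then obtain X where X: "\<And>n. J (X n) < m + 1 / real (Suc n)"
    by metis
  have par: "(norm (x - y))\<^sup>2 = 2 * J x + 2 * J y - 4 * J ((1/2) *\<^sub>R (x + y))" for x y
    by (simp add: J_def g.scaleR g.add power2_norm_eq_inner inner_simps inner_commute algebra_simps)
  have close: "(norm (X i - X j))\<^sup>2 < 4 / real (Suc n)" if "n \<le> i" "n \<le> j" for n i j
  proof -
    have "1 / real (Suc i) \<le> 1 / real (Suc n)" "1 / real (Suc j) \<le> 1 / real (Suc n)"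
      using that by (auto intro!: divide_left_mono)
    then show ?thesis
      using par[of "X i" "X j"] X[of i] X[of j] m_le[of "(1/2) *\<^sub>R (X i + X j)"] by argo
  qed
  have "Cauchy X"
  proof (rule CauchyI)
    fix e :: real assume "0 < e"
    then obtain n where n: "4 / e\<^sup>2 < real n"
      using reals_Archimedean2 by blast
    have "(norm (X i - X j))\<^sup>2 < e\<^sup>2" if "n \<le> i" "n \<le> j" for i j
    proof -
      have "4 / real (Suc n) \<le> e\<^sup>2"
        using n \<open>0 < e\<close> by (simp add: field_simps add_strict_increasing2 less_imp_le)
      then show ?thesis using close[OF that] by linarith
    qed
    then show "\<exists>M. \<forall>i\<ge>M. \<forall>j\<ge>M. norm (X i - X j) < e"
      using \<open>0 < e\<close> by (meson less_imp_le power_less_imp_less_base)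
  qed
  then obtain z where z: "X \<longlonglongrightarrow> z"
    using Cauchy_convergent convergent_def by blast
  have "(\<lambda>n. J (X n)) \<longlonglongrightarrow> J z"
    unfolding J_def by (intro tendsto_intros g.tendsto z)
  moreover have "(\<lambda>n. m + 1 / real (Suc n)) \<longlonglongrightarrow> m + 0"
    using LIMSEQ_inverse_real_of_nat by (intro tendsto_intros) (simp add: inverse_eq_divide)
  ultimately have "J z \<le> m + 0"
    by (rule LIMSEQ_le) (use X less_imp_le in blast)
  then have min: "J z \<le> J (z + t *\<^sub>R x)" for t x
    using m_le[of "z + t *\<^sub>R x"] by simp
  have "g x = inner x z" for x
  proof -
    define b where "b = inner x z - g x"
    have quad: "0 \<le> 2 * t * b + t\<^sup>2 * (norm x)\<^sup>2" for t
    proof -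
      have "J (z + t *\<^sub>R x) = J z + 2 * t * b + t\<^sup>2 * (norm x)\<^sup>2"
        unfolding J_def b_def power2_norm_eq_inner
        by (simp add: g.scaleR g.add inner_simps inner_commute algebra_simps power2_eq_square[of t])
      with min[of t x] show ?thesis by linarith
    qed
    define q where "q = (norm x)\<^sup>2 + 1"
    have q: "0 < q" "(norm x)\<^sup>2 \<le> q"
      unfolding q_def by (auto simp: add_nonneg_pos)
    have "0 \<le> 2 * (- b / q) * b + (- b / q)\<^sup>2 * q"
      using quad[of "- b / q"] q mult_left_mono[OF q(2), of "(- b / q)\<^sup>2"] by simp
    also have "\<dots> = - (b\<^sup>2 / q)"
      using q by (simp add: power2_eq_square field_simps)
    finally have "b = 0"
      using q by (simp add: divide_le_0_iff)
    then show ?thesis by (simp add: b_def)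
  qed
  then show ?thesis by blast
qed

lemma adj_unique:
  assumes "\<forall>x y. cinner (blinfun_apply T x) y = cinner x (blinfun_apply S y)"
  shows "adj T = S"
  unfolding adj_def
proof (rule the_equality)
  fix R assume R: "\<forall>x y. cinner (blinfun_apply T x) y = cinner x (blinfun_apply R y)"
  have "inner x (blinfun_apply R y - blinfun_apply S y) = 0" for x y
    using R assms by (metis Re_cinner eq_iff_diff_eq_0 inner_diff_right)
  then show "R = S"
    by (intro blinfun_eqI) (metis eq_iff_diff_eq_0 inner_eq_zero_iff)
qed (fact assms)

lemma cinner_adj:
  fixes T :: "'h::chilbert_space \<Rightarrow>\<^sub>L 'h"
  assumes "T \<in> bounded_ops"
  shows "cinner (blinfun_apply T x) y = cinner x (blinfun_apply (adj T) y)"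
proof -
  have "\<exists>z. \<forall>x. inner (blinfun_apply T x) y = inner x z" for y
    by (rule riesz_representation)
      (intro bounded_linear_intros)
  then obtain s where s: "\<And>x y. inner (blinfun_apply T x) y = inner x (s y)"
    by metis
  have eqI: "u = v" if "\<And>x. inner x u = inner x v" for u v :: 'h
    using that[of "u - v"] by (metis eq_iff_diff_eq_0 inner_diff_right inner_eq_zero_iff)
  have "bounded_linear s"
  proof (rule bounded_linear_intro)
    show "s (x + y) = s x + s y" for x y
      by (rule eqI) (simp flip: s add: inner_simps)
    show "s (r *\<^sub>R x) = r *\<^sub>R s x" for r x
      by (rule eqI) (simp flip: s add: inner_simps)
    show "norm (s y) \<le> norm y * norm T" for y
    proof (cases "s y = 0")
      case False
      have "norm (s y) * norm (s y) = inner (blinfun_apply T (s y)) y"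
        by (simp add: s power2_norm_eq_inner flip: power2_eq_square)
      also have "\<dots> \<le> norm (blinfun_apply T (s y)) * norm y"
        by (rule norm_cauchy_schwarz)
      also have "\<dots> \<le> norm T * norm (s y) * norm y"
        by (intro mult_right_mono norm_blinfun) auto
      finally show ?thesis
        using False by (simp add: mult_ac)
    qed simp
  qed
  then have *: "blinfun_apply (Blinfun s) = s"
    by (rule bounded_linear_Blinfun_apply)
  have "\<forall>x y. cinner (blinfun_apply T x) y = cinner x (blinfun_apply (Blinfun s) y)"
    using assms by (simp add: * complex_eq_iff Re_cinner Im_cinner bounded_ops_def flip: s)
  with adj_unique[OF this] show ?thesis
    by simp
qed


section \<open>Type $\mathrm{II}_1$ factors\<close>

definition commutant :: "('h::chilbert_space \<Rightarrow>\<^sub>L 'h) set \<Rightarrow> ('h \<Rightarrow>\<^sub>L 'h) set" where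
  "commutant S = {T \<in> bounded_ops. \<forall>A\<in>S. T o\<^sub>L A = A o\<^sub>L T}"

definition von_neumann_algebra :: "('h::chilbert_space \<Rightarrow>\<^sub>L 'h) set \<Rightarrow> bool" where
  "von_neumann_algebra M \<longleftrightarrow> (\<forall>T\<in>M. adj T \<in> M) \<and> commutant (commutant M) = M"

definition factor :: "('h::chilbert_space \<Rightarrow>\<^sub>L 'h) set \<Rightarrow> bool" where
  "factor M \<longleftrightarrow> von_neumann_algebra M \<and> (id_blinfun :: 'h \<Rightarrow>\<^sub>L 'h) \<noteq> 0
     \<and> M \<inter> commutant M = range (\<lambda>c. scale_op c id_blinfun)"

definition projections :: "('h::chilbert_space \<Rightarrow>\<^sub>L 'h) set \<Rightarrow> ('h \<Rightarrow>\<^sub>L 'h) set" where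
  "projections M = {E \<in> M. adj E = E \<and> E o\<^sub>L E = E}"

definition unitaries :: "('h::chilbert_space \<Rightarrow>\<^sub>L 'h) set \<Rightarrow> ('h \<Rightarrow>\<^sub>L 'h) set" where
  "unitaries M = {U \<in> M. adj U o\<^sub>L U = id_blinfun \<and> U o\<^sub>L adj U = id_blinfun}"

text \<open>
  Murray--von Neumann: the identity is a finite projection (it is not equivalent to a proper
  subprojection) and there are no minimal projections.
\<close>

definition type_II1_factor :: "('h::chilbert_space \<Rightarrow>\<^sub>L 'h) set \<Rightarrow> bool" where
  "type_II1_factor M \<longleftrightarrow> factor M
     \<and> (\<forall>V\<in>M. adj V o\<^sub>L V = id_blinfun \<longrightarrow> V o\<^sub>L adj V = id_blinfun)
     \<and> (\<forall>E\<in>projections M. E \<noteq> 0 \<longrightarrow>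
          (\<exists>F\<in>projections M. F \<noteq> 0 \<and> F \<noteq> E \<and> E o\<^sub>L F = F))"

definition tracial_state ::
  "('h::chilbert_space \<Rightarrow>\<^sub>L 'h) set \<Rightarrow> (('h \<Rightarrow>\<^sub>L 'h) \<Rightarrow> complex) \<Rightarrow> bool" where
  "tracial_state M \<tau> \<longleftrightarrow>
     (\<forall>S\<in>M. \<forall>T\<in>M. \<tau> (S + T) = \<tau> S + \<tau> T)
     \<and> (\<forall>c. \<forall>T\<in>M. \<tau> (scale_op c T) = c * \<tau> T)
     \<and> (\<forall>T\<in>M. \<tau> (adj T o\<^sub>L T) \<in> \<real>\<^sub>\<ge>\<^sub>0)
     \<and> \<tau> id_blinfun = 1
     \<and> (\<forall>S\<in>M. \<forall>T\<in>M. \<tau> (S o\<^sub>L T) = \<tau> (T o\<^sub>L S))"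


section \<open>Unitarily invariant norms and the topologies they induce\<close>

definition unitarily_invariant_norm ::
  "('h::chilbert_space \<Rightarrow>\<^sub>L 'h) set \<Rightarrow> (('h \<Rightarrow>\<^sub>L 'h) \<Rightarrow> real) \<Rightarrow> bool" where
  "unitarily_invariant_norm M N \<longleftrightarrow>
     (\<forall>T\<in>M. 0 \<le> N T \<and> (N T = 0 \<longleftrightarrow> T = 0))
     \<and> (\<forall>S\<in>M. \<forall>T\<in>M. N (S + T) \<le> N S + N T)
     \<and> (\<forall>c. \<forall>T\<in>M. N (scale_op c T) = cmod c * N T)
     \<and> (\<forall>T\<in>M. \<forall>U\<in>unitaries M. \<forall>V\<in>unitaries M. N (U o\<^sub>L T o\<^sub>L V) = N T)"

text \<open>
  The filter of nonzero projections \<open>E\<close> of \<open>M\<close> with \<open>\<tau>(E) \<rightarrow> 0+\<close>; here and below \<open>Re\<close> only converts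
  the type, since a tracial state is real and nonnegative on projections.
\<close>

definition small_projections ::
  "('h::chilbert_space \<Rightarrow>\<^sub>L 'h) set \<Rightarrow> (('h \<Rightarrow>\<^sub>L 'h) \<Rightarrow> complex) \<Rightarrow> ('h \<Rightarrow>\<^sub>L 'h) filter" where
  "small_projections M \<tau> =
     inf (filtercomap (\<lambda>E. Re (\<tau> E)) (at_right 0)) (principal (projections M - {0}))"

definition singular_norm ::
  "('h::chilbert_space \<Rightarrow>\<^sub>L 'h) set \<Rightarrow> (('h \<Rightarrow>\<^sub>L 'h) \<Rightarrow> complex) \<Rightarrow> (('h \<Rightarrow>\<^sub>L 'h) \<Rightarrow> real) \<Rightarrow> bool" where
  "singular_norm M \<tau> N \<longleftrightarrow> (\<exists>L>0. (N \<longlongrightarrow> L) (small_projections M \<tau>))"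

definition continuous_norm ::
  "('h::chilbert_space \<Rightarrow>\<^sub>L 'h) set \<Rightarrow> (('h \<Rightarrow>\<^sub>L 'h) \<Rightarrow> complex) \<Rightarrow> (('h \<Rightarrow>\<^sub>L 'h) \<Rightarrow> real) \<Rightarrow> bool" where
  "continuous_norm M \<tau> N \<longleftrightarrow> (N \<longlongrightarrow> 0) (small_projections M \<tau>)"

text \<open>
  The library's \<^locale>\<open>Metric_space\<close> wants a globally nonnegative and symmetric distance, whereas
  \<open>N\<close> is only meaningful on \<open>M\<close>; hence the case distinction.
\<close>

definition norm_dist ::
  "('h::chilbert_space \<Rightarrow>\<^sub>L 'h) set \<Rightarrow> (('h \<Rightarrow>\<^sub>L 'h) \<Rightarrow> real) \<Rightarrow> ('h \<Rightarrow>\<^sub>L 'h) \<Rightarrow> ('h \<Rightarrow>\<^sub>L 'h) \<Rightarrow> real" where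
  "norm_dist M N S T = (if S \<in> M \<and> T \<in> M then N (S - T) else 0)"

definition norm_topology ::
  "('h::chilbert_space \<Rightarrow>\<^sub>L 'h) set \<Rightarrow> (('h \<Rightarrow>\<^sub>L 'h) \<Rightarrow> real) \<Rightarrow> ('h \<Rightarrow>\<^sub>L 'h) topology" where
  "norm_topology M N = Metric_space.mtopology M (norm_dist M N)"

definition measure_nbhd ::
  "('h::chilbert_space \<Rightarrow>\<^sub>L 'h) set \<Rightarrow> (('h \<Rightarrow>\<^sub>L 'h) \<Rightarrow> complex) \<Rightarrow> real \<Rightarrow> real \<Rightarrow> ('h \<Rightarrow>\<^sub>L 'h) set" where
  "measure_nbhd M \<tau> \<epsilon> \<delta> =
     {T \<in> M. \<exists>E\<in>projections M. Re (\<tau> E) < \<delta> \<and> norm (T o\<^sub>L (id_blinfun - E)) < \<epsilon>}"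

text \<open>
  The translation-invariant topology with the sets \<^const>\<open>measure_nbhd\<close> as a base of neighborhoods
  of \<open>0\<close>: a set is open iff it contains a translate of some such set around each of its points.
\<close>

definition measure_topology ::
  "('h::chilbert_space \<Rightarrow>\<^sub>L 'h) set \<Rightarrow> (('h \<Rightarrow>\<^sub>L 'h) \<Rightarrow> complex) \<Rightarrow> ('h \<Rightarrow>\<^sub>L 'h) topology" where
  "measure_topology M \<tau> = topology (\<lambda>U. U \<subseteq> M \<and>
     (\<forall>T\<in>U. \<exists>\<epsilon>>0. \<exists>\<delta>>0. (+) T ` measure_nbhd M \<tau> \<epsilon> \<delta> \<subseteq> U))"

definition op_unit_ball :: "('h::chilbert_space \<Rightarrow>\<^sub>L 'h) set \<Rightarrow> ('h \<Rightarrow>\<^sub>L 'h) set" where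
  "op_unit_ball M = {T \<in> M. norm T \<le> 1}"


subsection \<open>Well-definedness of the topologies\<close>

lemma bounded_ops_diff: "S \<in> bounded_ops \<Longrightarrow> T \<in> bounded_ops \<Longrightarrow> S - T \<in> bounded_ops"
proof -
  have "c *\<^sub>C x - c *\<^sub>C y = c *\<^sub>C (x - y)" for c and x y :: "'a::chilbert_space"
    by (metis add_diff_cancel_right' diff_add_cancel scaleC_add_right)
  then show "S \<in> bounded_ops \<Longrightarrow> T \<in> bounded_ops \<Longrightarrow> S - T \<in> bounded_ops"
    by (simp add: bounded_ops_def blinfun.diff_left)
qed

lemma commutant_diff:
  assumes "S \<in> commutant A" "T \<in> commutant A"
  shows "S - T \<in> commutant A"
proof -
  interpret bounded_bilinear "(o\<^sub>L) :: ('a \<Rightarrow>\<^sub>L 'a) \<Rightarrow> ('a \<Rightarrow>\<^sub>L 'a) \<Rightarrow> ('a \<Rightarrow>\<^sub>L 'a)"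
    by (rule bounded_bilinear_blinfun_compose)
  show ?thesis
    using assms by (simp add: commutant_def bounded_ops_diff diff_left diff_right)
qed

lemma von_neumann_algebra_diff:
  "von_neumann_algebra M \<Longrightarrow> S \<in> M \<Longrightarrow> T \<in> M \<Longrightarrow> S - T \<in> M"
  unfolding von_neumann_algebra_def by (metis commutant_diff)

lemma Metric_space_norm_dist:
  assumes M: "von_neumann_algebra M" and N: "unitarily_invariant_norm M N"
  shows "Metric_space M (norm_dist M N)"
proof
  note diff = von_neumann_algebra_diff[OF M]
  have nonneg: "0 \<le> N T" and zero: "N T = 0 \<longleftrightarrow> T = 0"
    and scale: "N (scale_op c T) = cmod c * N T" if "T \<in> M" for T c
    using N that by (simp_all add: unitarily_invariant_norm_def)
  have triangle: "N (S + T) \<le> N S + N T" if "S \<in> M" "T \<in> M" for S T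
    using N that by (simp add: unitarily_invariant_norm_def)
  show "0 \<le> norm_dist M N S T" for S T
    by (simp add: norm_dist_def nonneg diff)
  show "norm_dist M N S T = norm_dist M N T S" for S T
  proof (cases "S \<in> M \<and> T \<in> M")
    case True
    have "scale_op (- 1) (S - T) = T - S"
    proof (rule blinfun_eqI)
      fix x
      have "(- 1) *\<^sub>C y = - y" for y :: 'a
        using scaleC_of_real[of "-1" y] by simp
      then show "blinfun_apply (scale_op (- 1) (S - T)) x = blinfun_apply (T - S) x"
        by (simp add: scale_op.rep_eq blinfun.diff_left)
    qed
    then show ?thesis
      using True scale[OF diff[of S T], of "- 1"] by (simp add: norm_dist_def)
  qed (auto simp: norm_dist_def)
  show "norm_dist M N S T = 0 \<longleftrightarrow> S = T" if "S \<in> M" "T \<in> M" for S T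
    using that by (simp add: norm_dist_def zero diff)
  show "norm_dist M N R T \<le> norm_dist M N R S + norm_dist M N S T"
    if "R \<in> M" "S \<in> M" "T \<in> M" for R S T
    using that triangle[OF diff[of R S] diff[of S T]] by (simp add: norm_dist_def)
qed

lemma openin_measure_topology:
  "openin (measure_topology M \<tau>) U \<longleftrightarrow>
     U \<subseteq> M \<and> (\<forall>T\<in>U. \<exists>\<epsilon>>0. \<exists>\<delta>>0. (+) T ` measure_nbhd M \<tau> \<epsilon> \<delta> \<subseteq> U)"
proof -
  define Q where "Q T U \<longleftrightarrow> (\<exists>\<epsilon>>0. \<exists>\<delta>>0. (+) T ` measure_nbhd M \<tau> \<epsilon> \<delta> \<subseteq> U)" for T U
  have mono: "measure_nbhd M \<tau> \<epsilon> \<delta> \<subseteq> measure_nbhd M \<tau> \<epsilon>' \<delta>'" if "\<epsilon> \<le> \<epsilon>'" "\<delta> \<le> \<delta>'" for \<epsilon> \<delta> \<epsilon>' \<delta>'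
    using that unfolding measure_nbhd_def by (blast intro: less_le_trans)
  have Q_Int: "Q T (U \<inter> V)" if Q: "Q T U" "Q T V" for T U V
  proof -
    obtain e d e' d' where e: "0 < e" "0 < d" "(+) T ` measure_nbhd M \<tau> e d \<subseteq> U"
      and e': "0 < e'" "0 < d'" "(+) T ` measure_nbhd M \<tau> e' d' \<subseteq> V"
      using Q unfolding Q_def by metis
    have "(+) T ` measure_nbhd M \<tau> (min e e') (min d d') \<subseteq> U"
      by (rule order_trans[OF image_mono[OF mono] e(3)]) auto
    moreover have "(+) T ` measure_nbhd M \<tau> (min e e') (min d d') \<subseteq> V"
      by (rule order_trans[OF image_mono[OF mono] e'(3)]) auto
    ultimately show ?thesis
      unfolding Q_def using e(1,2) e'(1,2) by (metis le_inf_iff min_less_iff_conj)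
  qed
  have Q_mono: "Q T V" if "Q T U" "U \<subseteq> V" for T U V
    using that unfolding Q_def by (meson order_trans)
  have "istopology (\<lambda>U. U \<subseteq> M \<and> (\<forall>T\<in>U. Q T U))"
    unfolding istopology_def
  proof (intro conjI allI impI)
    fix K assume K: "\<forall>U\<in>K. U \<subseteq> M \<and> (\<forall>T\<in>U. Q T U)"
    then show "\<Union> K \<subseteq> M" by blast
    show "\<forall>T\<in>\<Union> K. Q T (\<Union> K)"
      using K Q_mono by (meson UnionE Union_upper)
  qed (use Q_Int in auto)
  then show ?thesis
    unfolding measure_topology_def Q_def[symmetric] by (simp add: topology_inverse')
qed

end

theory Submission
  imports Defs
begin

text \<open>
  Both halves rest on one estimate that turns a lower bound for an operator \<open>T\<close> into a projection.
  If \<open>Q\<close> is the spectral projection of \<open>|T|\<close> above the level \<open>\<mu> > 0\<close>, then \<open>\<parallel>T(1 - Q)\<parallel> \<le> \<mu>\<close>, and \<open>T\<close>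
  has a left inverse on the range of \<open>Q\<close>: there is \<open>Z\<close> in the algebra with \<open>Z T Q = Q\<close> and
  \<open>\<parallel>Z\<parallel> \<le> \<parallel>T\<parallel> / \<mu>\<^sup>2\<close>. Every operator of norm at most \<open>1\<close> is half a combination of four unitaries with
  coefficients of modulus \<open>1\<close>, so a unitarily invariant norm satisfies \<open>N(A T) \<le> 2 \<parallel>A\<parallel> N(T)\<close> and the
  same on the right. Together this gives \<open>N(Q) \<le> 4 (\<parallel>T\<parallel> / \<mu>\<^sup>2) N(T)\<close> (lemma \<open>spectral_projection_N\<close>).

  Singular case. As there are no minimal projections, every nonzero projection dominates nonzero
  projections of arbitrarily small trace, so singularity bounds \<open>N\<close> below on all nonzero projections.
  Applied with \<open>\<mu> = \<parallel>T\<parallel> / 2\<close>, the estimate yields \<open>c \<parallel>T\<parallel> \<le> N(T)\<close>, while \<open>N(T) \<le> 2 N(1) \<parallel>T\<parallel>\<close> always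
  holds: the two norms are equivalent.

  Continuous case. If \<open>N(T)\<close> is small then so is \<open>N(Q)\<close>, and \<open>Q\<close> has small trace because
  \<open>\<tau>(Q) N(1) \<le> 8 N(Q)\<close> (lemma \<open>tr_le_N\<close>); so \<open>T\<close> is small in measure. Conversely, if \<open>\<parallel>T\<parallel> \<le> 2\<close>, \<open>\<tau>(E)\<close>
  is small and \<open>\<parallel>T(1 - E)\<parallel>\<close> is small, then \<open>N(T) \<le> 4 N(E) + 2 N(1) \<parallel>T(1 - E)\<parallel>\<close> is small by continuity.
  To compare the two subspace topologies it remains to see that the operator unit ball is closed in
  the measure topology (lemma \<open>unit_ball_measure_closed\<close>): if \<open>\<parallel>T\<parallel> > 1\<close>, a contraction close to \<open>T\<close> off a
  projection \<open>E\<close> forces \<open>E\<close> to be bounded below on a fixed spectral projection \<open>Q\<close> of \<open>|T|\<close>, hence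
  \<open>\<tau>(E)\<close> is at least a fixed positive multiple of \<open>\<tau>(Q)\<close>.

  Two facts need the structure of a finite factor: \<open>\<tau>\<close> is faithful, and \<open>\<tau>(Q) N(1) \<le> 8 N(Q)\<close>. Both come
  from covering the identity by \<open>k + 1\<close> compressed copies \<open>V\<^sub>i Q V\<^sub>i\<^sup>*\<close> of \<open>Q\<close> with \<open>k \<tau>(Q) \<le> 1\<close> (lemma
  \<open>finite_cover\<close>). The copies are chosen greedily, by comparability of projections; the procedure
  stops because infinitely many orthogonal copies of \<open>Q\<close> would produce a non-unitary isometry.

  The operator theory behind this is elementary. Square roots come from an iteration in the operator
  norm, spectral projections from the kernel of \<open>|Y| - Y\<close> with \<open>Y = T\<^sup>* T - \<mu>\<^sup>2\<close>, inverses from a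
  contraction argument. Partial isometries are built from their graphs, which are subspaces of
  \<open>H \<times> H\<close> invariant under the commutant: inclusion of graphs is the order that Zorn's lemma needs, and
  no sums of infinite families of operators occur.
\<close>

instance chilbert_space \<subseteq> banach ..

section \<open>Bounded operators and adjoints\<close>

lemma blinfun_inner_eqI:
  fixes S T :: "'a::real_inner \<Rightarrow>\<^sub>L 'a"
  assumes "\<And>x y. inner (S x) y = inner (T x) y"
  shows "S = T"
  by (rule blinfun_eqI) (use assms vector_eq_rdot in blast)

lemma blinfun_eq_iff: "S = T \<longleftrightarrow> (\<forall>x. blinfun_apply S x = blinfun_apply T x)"
  using blinfun_eqI by auto

lemma blinfun_compose_assoc: "(A o\<^sub>L B) o\<^sub>L C = A o\<^sub>L (B o\<^sub>L C)"
  by (rule blinfun_eqI) simp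

lemma blinfun_compose_id_left: "id_blinfun o\<^sub>L T = T"
  and blinfun_compose_id_right: "T o\<^sub>L id_blinfun = T"
  by (simp_all add: blinfun_eq_iff)

lemma scaleC_minus_one: "(- 1) *\<^sub>C x = - (x :: 'h::chilbert_space)"
  using scaleC_of_real[of "-1" x] by simp

lemma scaleC_diff_right: "c *\<^sub>C (x - y) = c *\<^sub>C x - c *\<^sub>C (y :: 'h::chilbert_space)"
  by (metis add_diff_cancel_right' diff_add_cancel scaleC_add_right)

lemma scaleC_zero_right [simp]: "c *\<^sub>C 0 = (0 :: 'h::chilbert_space)"
  using scaleC_diff_right[of c 0 0] by simp

lemma scaleC_minus_left: "(- c) *\<^sub>C x = - (c *\<^sub>C x :: 'h::chilbert_space)"
  using scaleC_minus_one[of "c *\<^sub>C x"] by (simp add: scaleC_scaleC)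

lemma scaleC_scaleR: "c *\<^sub>C r *\<^sub>R x = r *\<^sub>R c *\<^sub>C (x :: 'h::chilbert_space)"
  unfolding scaleC_of_real[symmetric] scaleC_scaleC by (simp add: mult.commute)

text \<open>
  Real multiples are particular complex multiples; this carries the complex homogeneity of a trace,
  of a unitarily invariant norm and of the adjoint over to the real scalars of the type.
\<close>

lemma scaleR_op: "r *\<^sub>R (T :: 'h::chilbert_space \<Rightarrow>\<^sub>L 'h) = scale_op (complex_of_real r) T"
  by (rule blinfun_eqI) (simp add: scale_op.rep_eq scaleC_of_real blinfun.scaleR_left)

lemma inner_adj:
  "T \<in> bounded_ops \<Longrightarrow> inner (blinfun_apply T x) y = inner x (blinfun_apply (adj T) y)"
  using cinner_adj[of T x y] by (simp flip: Re_cinner)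

lemma inner_adj':
  "T \<in> bounded_ops \<Longrightarrow> inner (blinfun_apply (adj T) x) y = inner x (blinfun_apply T y)"
  by (metis inner_adj inner_commute)

lemma adj_eqI:
  assumes "T \<in> bounded_ops" "\<And>x y. inner (blinfun_apply T x) y = inner x (blinfun_apply S y)"
  shows "adj T = S"
  by (rule blinfun_eqI) (metis assms inner_adj vector_eq_ldot)

lemma bounded_ops_intros:
  fixes S T :: "'h::chilbert_space \<Rightarrow>\<^sub>L 'h"
  shows "id_blinfun \<in> bounded_ops" "0 \<in> bounded_ops"
    "S \<in> bounded_ops \<Longrightarrow> T \<in> bounded_ops \<Longrightarrow> S + T \<in> bounded_ops"
    "S \<in> bounded_ops \<Longrightarrow> T \<in> bounded_ops \<Longrightarrow> S o\<^sub>L T \<in> bounded_ops"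
    "T \<in> bounded_ops \<Longrightarrow> scale_op c T \<in> bounded_ops"
  by (auto simp: bounded_ops_def blinfun.add_left scaleC_add_right scale_op.rep_eq
      scaleC_scaleC mult.commute)

lemma adj_bounded_ops:
  assumes T: "T \<in> bounded_ops"
  shows "adj T \<in> bounded_ops"
proof -
  have "blinfun_apply (adj T) (c *\<^sub>C y) = c *\<^sub>C blinfun_apply (adj T) y" for c y
  proof -
    have "inner x (blinfun_apply (adj T) (c *\<^sub>C y)) = inner x (c *\<^sub>C blinfun_apply (adj T) y)" for x
      by (metis Re_cinner T cinner_adj cinner_scaleC_right)
    then show ?thesis by (meson vector_eq_ldot)
  qed
  then show ?thesis by (simp add: bounded_ops_def)
qed

lemma adj_adj: "T \<in> bounded_ops \<Longrightarrow> adj (adj T) = T"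
  by (rule adj_eqI) (auto simp: adj_bounded_ops inner_adj')

lemma adj_compose:
  "S \<in> bounded_ops \<Longrightarrow> T \<in> bounded_ops \<Longrightarrow> adj (S o\<^sub>L T) = adj T o\<^sub>L adj S"
  by (rule adj_eqI) (auto simp: bounded_ops_intros inner_adj)

lemma adj_add: "S \<in> bounded_ops \<Longrightarrow> T \<in> bounded_ops \<Longrightarrow> adj (S + T) = adj S + adj T"
  by (rule adj_eqI) (auto simp: bounded_ops_intros inner_adj blinfun.bilinear_simps inner_simps)

lemma adj_diff: "S \<in> bounded_ops \<Longrightarrow> T \<in> bounded_ops \<Longrightarrow> adj (S - T) = adj S - adj T"
  by (rule adj_eqI) (auto simp: bounded_ops_diff inner_adj blinfun.bilinear_simps inner_simps)

lemma adj_id: "adj id_blinfun = (id_blinfun :: 'h::chilbert_space \<Rightarrow>\<^sub>L 'h)"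
  by (rule adj_eqI) (auto simp: bounded_ops_intros)

lemma adj_scale_op:
  assumes T: "T \<in> bounded_ops"
  shows "adj (scale_op c T) = scale_op (cnj c) (adj T)"
proof (rule adj_unique, intro allI)
  fix x y
  show "cinner (blinfun_apply (scale_op c T) x) y
      = cinner x (blinfun_apply (scale_op (cnj c) (adj T)) y)"
    by (simp add: scale_op.rep_eq cinner_scaleC_left cinner_scaleC_right cinner_adj[OF T])
qed

lemma norm_adj_le:
  assumes T: "T \<in> bounded_ops"
  shows "norm (adj T) \<le> norm T"
proof (rule norm_blinfun_bound)
  fix y
  let ?z = "blinfun_apply (adj T) y"
  have "norm ?z * norm ?z = inner (blinfun_apply T ?z) y"
    by (simp add: inner_adj[OF T] flip: power2_norm_eq_inner power2_eq_square)
  also have "\<dots> \<le> norm T * norm ?z * norm y"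
    by (rule order_trans[OF norm_cauchy_schwarz mult_right_mono[OF norm_blinfun]]) simp
  finally show "norm ?z \<le> norm T * norm y"
    by (cases "?z = 0") (simp_all add: mult_ac)
qed simp

lemma inner_adj_comp:
  assumes "T \<in> bounded_ops"
  shows "inner (blinfun_apply (adj T o\<^sub>L T) x) y = inner (blinfun_apply T x) (blinfun_apply T y)"
  by (simp add: inner_adj'[OF assms])

lemma norm_scale_op: "norm (scale_op c T) = cmod c * norm T"
proof -
  have le: "norm (scale_op c T) \<le> cmod c * norm T" for c and T :: "'a \<Rightarrow>\<^sub>L 'a"
    by (rule norm_blinfun_bound)
      (auto simp: scale_op.rep_eq norm_scaleC mult.assoc intro!: mult_left_mono norm_blinfun)
  show ?thesis
  proof (cases "c = 0")
    case False
    have "scale_op (inverse c) (scale_op c T) = T"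
      by (rule blinfun_eqI)
        (use False scaleC_of_real[of 1] in \<open>simp add: scale_op.rep_eq scaleC_scaleC\<close>)
    then have "norm T \<le> inverse (cmod c) * norm (scale_op c T)"
      using le[of "inverse c" "scale_op c T"] by (simp add: norm_inverse)
    then show ?thesis
      using le[of c T] False by (simp add: field_simps)
  qed (use le[of 0 T] in auto)
qed

section \<open>Closure properties of von Neumann algebras\<close>

locale von_neumann =
  fixes M :: "('h::chilbert_space \<Rightarrow>\<^sub>L 'h) set"
  assumes vn: "von_neumann_algebra M"
begin

text \<open>
  The bicommutant property as a pointwise criterion. It puts projections and partial
  isometries into the algebra, because their constructions are compatible with the commutant.
\<close>

lemma mem_iff:
  "T \<in> M \<longleftrightarrow> T \<in> bounded_ops \<and>
     (\<forall>S\<in>commutant M. \<forall>x. blinfun_apply T (blinfun_apply S x) = blinfun_apply S (blinfun_apply T x))"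
proof -
  have "T \<in> M \<longleftrightarrow> T \<in> commutant (commutant M)"
    using vn by (simp add: von_neumann_algebra_def)
  also have "\<dots> \<longleftrightarrow> T \<in> bounded_ops \<and> (\<forall>S\<in>commutant M. T o\<^sub>L S = S o\<^sub>L T)"
    by (simp add: commutant_def[of "commutant M"])
  also have "\<dots> \<longleftrightarrow> T \<in> bounded_ops \<and>
     (\<forall>S\<in>commutant M. \<forall>x. blinfun_apply T (blinfun_apply S x) = blinfun_apply S (blinfun_apply T x))"
    by (simp add: blinfun_eq_iff)
  finally show ?thesis .
qed

lemma bounded: "T \<in> M \<Longrightarrow> T \<in> bounded_ops"
  by (simp add: mem_iff)

lemma commutant_bounded: "S \<in> commutant M \<Longrightarrow> S \<in> bounded_ops"
  by (simp add: commutant_def)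

lemma commute:
  "T \<in> M \<Longrightarrow> S \<in> commutant M
    \<Longrightarrow> blinfun_apply T (blinfun_apply S x) = blinfun_apply S (blinfun_apply T x)"
  by (simp add: mem_iff)

lemma adj_mem [simp]: "T \<in> M \<Longrightarrow> adj T \<in> M"
  using vn by (simp add: von_neumann_algebra_def)

lemma id_mem [simp]: "id_blinfun \<in> M" and zero_mem [simp]: "0 \<in> M"
  by (auto simp: mem_iff bounded_ops_intros)

lemma add_mem [simp]: "S \<in> M \<Longrightarrow> T \<in> M \<Longrightarrow> S + T \<in> M"
  by (simp add: mem_iff bounded_ops_intros blinfun.bilinear_simps)

lemma diff_mem [simp]: "S \<in> M \<Longrightarrow> T \<in> M \<Longrightarrow> S - T \<in> M"
  by (rule von_neumann_algebra_diff[OF vn])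

lemma uminus_mem [simp]: "T \<in> M \<Longrightarrow> - T \<in> M"
  using diff_mem[of 0 T] by simp

lemma comp_mem [simp]: "S \<in> M \<Longrightarrow> T \<in> M \<Longrightarrow> S o\<^sub>L T \<in> M"
  by (simp add: mem_iff bounded_ops_intros)

lemma scale_op_mem [simp]: "T \<in> M \<Longrightarrow> scale_op c T \<in> M"
proof -
  assume T: "T \<in> M"
  have "S (c *\<^sub>C x) = c *\<^sub>C S x" if "S \<in> commutant M" for S x
    using commutant_bounded[OF that] by (simp add: bounded_ops_def)
  then show "scale_op c T \<in> M"
    using T by (simp add: mem_iff bounded_ops_intros scale_op.rep_eq)
qed

lemma scaleR_mem [simp]: "T \<in> M \<Longrightarrow> r *\<^sub>R T \<in> M"
  by (simp add: scaleR_op)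

lemma sum_mem [simp]: "(\<And>i. i \<in> I \<Longrightarrow> f i \<in> M) \<Longrightarrow> sum f I \<in> M"
  by (induction I rule: infinite_finite_induct) auto

text \<open>
  Because of this, invariance under the commutant includes invariance under complex scalars, so that
  real subspaces and real-linear maps invariant under the commutant are automatically complex.
\<close>

lemma scale_id_commutant: "scale_op c id_blinfun \<in> commutant M"
proof -
  have "scale_op c id_blinfun o\<^sub>L A = A o\<^sub>L scale_op c id_blinfun" if "A \<in> M" for A
    using bounded[OF that] by (intro blinfun_eqI) (simp add: scale_op.rep_eq bounded_ops_def)
  then show ?thesis
    by (simp add: commutant_def bounded_ops_intros)
qed

lemma adj_commutant:
  assumes S: "S \<in> commutant M"
  shows "adj S \<in> commutant M"
proof -
  have "adj S o\<^sub>L A = A o\<^sub>L adj S" if A: "A \<in> M" for A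
  proof -
    have "adj A o\<^sub>L S = S o\<^sub>L adj A"
      using S A by (simp add: commutant_def)
    then have "adj (adj A o\<^sub>L S) = adj (S o\<^sub>L adj A)"
      by simp
    then show ?thesis
      using A S by (simp add: adj_compose bounded commutant_bounded adj_adj)
  qed
  then show ?thesis
    using S by (simp add: commutant_def adj_bounded_ops)
qed

lemma closed_algebra: "closed M"
proof -
  have "closed {T :: 'h \<Rightarrow>\<^sub>L 'h. blinfun_apply T (c *\<^sub>C x) = c *\<^sub>C blinfun_apply T x}" for c and x :: 'h
  proof -
    have "continuous_on UNIV (\<lambda>y::'h. c *\<^sub>C y)"
      using blinfun.continuous_on[of UNIV "\<lambda>y. scale_op c id_blinfun" "\<lambda>y. y"]
      by (simp add: scale_op.rep_eq)
    then have "continuous_on UNIV (\<lambda>T :: 'h \<Rightarrow>\<^sub>L 'h. c *\<^sub>C blinfun_apply T x)"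
      by (rule continuous_on_compose2) (auto intro!: continuous_intros)
    moreover have "continuous_on UNIV (\<lambda>T :: 'h \<Rightarrow>\<^sub>L 'h. blinfun_apply T (c *\<^sub>C x))"
      by (intro continuous_intros)
    ultimately show ?thesis
      by (intro closed_Collect_eq)
  qed
  then have 1: "closed (\<Inter>c. \<Inter>x. {T :: 'h \<Rightarrow>\<^sub>L 'h. blinfun_apply T (c *\<^sub>C x) = c *\<^sub>C blinfun_apply T x})"
    by (intro closed_INT ballI)
  have 2: "closed (\<Inter>S\<in>commutant M. \<Inter>x.
      {T :: 'h \<Rightarrow>\<^sub>L 'h. blinfun_apply T (blinfun_apply S x) = blinfun_apply S (blinfun_apply T x)})"
    by (intro closed_INT ballI closed_Collect_eq continuous_intros)
  have "(\<Inter>c. \<Inter>x. {T. blinfun_apply T (c *\<^sub>C x) = c *\<^sub>C blinfun_apply T x}) \<inter>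
     (\<Inter>S\<in>commutant M. \<Inter>x.
      {T. blinfun_apply T (blinfun_apply S x) = blinfun_apply S (blinfun_apply T x)}) = M"
    by (intro set_eqI) (simp add: mem_iff bounded_ops_def)
  then show ?thesis
    using closed_Int[OF 1 2] by (simp only:)
qed

end

section \<open>Square roots and absolute values\<close>

text \<open>
  A fixed point \<open>Y\<close> of \<open>Z \<mapsto> (X + Z\<^sup>2) / 2\<close> satisfies \<open>(1 - Y)\<^sup>2 = 1 - X\<close>. The iteration converges in norm even
  for \<open>\<parallel>X\<parallel> = 1\<close>, because its increments are dominated by those of the scalar iteration for \<open>X = 1\<close>,
  which increases and stays below \<open>1\<close>. The closed set \<open>\<C>\<close> transports to \<open>Y\<close> whatever properties
  the iteration preserves.
\<close>

lemma sqrt_iteration: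
  fixes X :: "'a::banach \<Rightarrow>\<^sub>L 'a"
  assumes X: "norm X \<le> 1"
    and \<C>: "closed \<C>" "0 \<in> \<C>" "\<And>Z. Z \<in> \<C> \<Longrightarrow> (1/2) *\<^sub>R (X + (Z o\<^sub>L Z)) \<in> \<C>"
  shows "\<exists>Y\<in>\<C>. norm Y \<le> 1 \<and> Y = (1/2) *\<^sub>R (X + (Y o\<^sub>L Y))"
proof -
  define F where "F Z = (1/2) *\<^sub>R (X + (Z o\<^sub>L Z))" for Z :: "'a \<Rightarrow>\<^sub>L 'a"
  define Y where "Y n = (F ^^ n) 0" for n
  define y where "y n = ((\<lambda>t. (1 + t\<^sup>2) / 2) ^^ n) (0::real)" for n
  have Y_Suc: "Y (Suc n) = F (Y n)" and y_Suc: "y (Suc n) = (1 + (y n)\<^sup>2) / 2"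
    and start: "Y 0 = 0" "y 0 = 0" for n
    by (simp_all add: Y_def y_def)
  have y01: "0 \<le> y n \<and> y n \<le> 1" for n
    by (induction n) (auto simp: start y_Suc power_le_one_iff)
  have norm_Y: "norm (Y n) \<le> y n" for n
  proof (induction n)
    case (Suc n)
    have "norm (Y n o\<^sub>L Y n) \<le> (y n)\<^sup>2"
      unfolding power2_eq_square
      by (rule order_trans[OF norm_blinfun_compose mult_mono']) (use Suc in auto)
    then have "norm (X + (Y n o\<^sub>L Y n)) \<le> 1 + (y n)\<^sup>2"
      using X by (intro norm_triangle_le) simp
    then show ?case
      by (simp add: Y_Suc y_Suc F_def)
  qed (simp add: start)
  have increment: "norm (Y (Suc n) - Y n) \<le> y (Suc n) - y n" for n
  proof (induction n)
    case 0
    show ?case using X by (simp add: start Y_Suc y_Suc F_def)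
  next
    case (Suc n)
    let ?D = "Y (Suc n) - Y n"
    have "F Z - F W = (1/2) *\<^sub>R ((Z o\<^sub>L (Z - W)) + ((Z - W) o\<^sub>L W))" for Z W
      by (rule blinfun_eqI) (simp add: F_def blinfun.bilinear_simps algebra_simps)
    then have "Y (Suc (Suc n)) - Y (Suc n) = (1/2) *\<^sub>R ((Y (Suc n) o\<^sub>L ?D) + (?D o\<^sub>L Y n))"
      by (metis Y_Suc)
    also have "norm \<dots> \<le> (y (Suc n) * (y (Suc n) - y n) + (y (Suc n) - y n) * y n) / 2"
    proof -
      have "norm (Y (Suc n) o\<^sub>L ?D) \<le> y (Suc n) * (y (Suc n) - y n)"
        by (rule order_trans[OF norm_blinfun_compose mult_mono']) (use norm_Y Suc in auto)
      moreover have "norm (?D o\<^sub>L Y n) \<le> (y (Suc n) - y n) * y n"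
        by (rule order_trans[OF norm_blinfun_compose mult_mono']) (use norm_Y Suc in auto)
      ultimately have "norm ((Y (Suc n) o\<^sub>L ?D) + (?D o\<^sub>L Y n))
          \<le> y (Suc n) * (y (Suc n) - y n) + (y (Suc n) - y n) * y n"
        by (intro norm_triangle_le) simp
      then show ?thesis by simp
    qed
    also have "\<dots> = y (Suc (Suc n)) - y (Suc n)"
    proof -
      have "y (Suc (Suc n)) - y (Suc n) = ((y (Suc n))\<^sup>2 - (y n)\<^sup>2) / 2"
        unfolding y_Suc[of "Suc n"] by (subst (2) y_Suc) (simp add: field_simps)
      then show ?thesis
        by (simp only: power2_eq_square) (simp add: algebra_simps)
    qed
    finally show ?case .
  qed
  have diff: "norm (Y m - Y n) \<le> y m - y n" if "n \<le> m" for m n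
    using that
  proof (induction m rule: dec_induct)
    case (step m)
    have "norm (Y (Suc m) - Y n) \<le> norm (Y (Suc m) - Y m) + norm (Y m - Y n)"
      using norm_triangle_ineq[of "Y (Suc m) - Y m" "Y m - Y n"] by simp
    then show ?case
      using step.IH increment[of m] by linarith
  qed simp
  have "incseq y"
    using increment by (intro incseq_SucI) (smt (verit) norm_ge_zero)
  then have "convergent y"
    using y01 by (intro Bseq_mono_convergent[OF BseqI'[of _ 1]]) (auto simp: incseq_def)
  then have "Cauchy y"
    by (rule convergent_Cauchy)
  have "Cauchy Y"
  proof (rule CauchyI)
    fix e :: real assume "0 < e"
    then obtain K where K: "\<And>m n. K \<le> m \<Longrightarrow> K \<le> n \<Longrightarrow> norm (y m - y n) < e"
      using CauchyD[OF \<open>Cauchy y\<close>] by blast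
    have "norm (Y m - Y n) < e" if "K \<le> m" "K \<le> n" for m n
    proof (cases "n \<le> m")
      case True
      then show ?thesis using diff[OF True] K[OF that] by simp
    next
      case False
      then show ?thesis using diff[of m n] K[OF that] by (simp add: norm_minus_commute)
    qed
    then show "\<exists>K. \<forall>m\<ge>K. \<forall>n\<ge>K. norm (Y m - Y n) < e" by blast
  qed
  then obtain Z where Z: "Y \<longlonglongrightarrow> Z"
    using Cauchy_convergent convergent_def by blast
  have "(\<lambda>n. F (Y n)) \<longlonglongrightarrow> F Z"
    unfolding F_def by (intro tendsto_intros Z bounded_bilinear.tendsto[OF bounded_bilinear_blinfun_compose])
  moreover have "(\<lambda>n. F (Y n)) \<longlonglongrightarrow> Z"
    unfolding Y_Suc[symmetric] by (rule LIMSEQ_Suc[OF Z])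
  ultimately have "Z = F Z"
    by (rule LIMSEQ_unique[symmetric])
  moreover have "Y n \<in> \<C>" for n
    by (induction n) (auto simp: start Y_Suc F_def \<C>)
  then have "Z \<in> \<C>"
    by (rule closed_sequentially[OF \<C>(1) _ Z])
  moreover have "norm Z \<le> 1"
    by (rule LIMSEQ_le_const2[OF tendsto_norm[OF Z]]) (use norm_Y y01 order_trans in blast)
  ultimately show ?thesis
    unfolding F_def by blast
qed

lemma selfadjoint_iff:
  "T \<in> bounded_ops \<Longrightarrow> adj T = T \<longleftrightarrow> (\<forall>x y. inner (T x) y = inner x (T y))"
  by (metis adj_eqI inner_adj)

context von_neumann
begin

text \<open>
  Membership in the algebra, self-adjointness and commutation with the commutant of \<open>X\<close> are preserved
  by the iteration, hence inherited by \<open>S = 1 - Y\<close>; positivity of \<open>S\<close> is \<open>\<parallel>Y\<parallel> \<le> 1\<close>.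
\<close>

lemma sqrt_one_minus:
  assumes X: "X \<in> M" "adj X = X" "norm X \<le> 1"
  shows "\<exists>S\<in>M. adj S = S \<and> S o\<^sub>L S = id_blinfun - X \<and> (\<forall>x. 0 \<le> inner (S x) x)
    \<and> (\<forall>A. A o\<^sub>L X = X o\<^sub>L A \<longrightarrow> A o\<^sub>L S = S o\<^sub>L A)"
proof -
  define \<C> where "\<C> = M \<inter> (\<Inter>x. \<Inter>y. {Z :: 'h \<Rightarrow>\<^sub>L 'h. inner (Z x) y = inner x (Z y)})
    \<inter> (\<Inter>A\<in>{A :: 'h \<Rightarrow>\<^sub>L 'h. A o\<^sub>L X = X o\<^sub>L A}. \<Inter>x. {Z :: 'h \<Rightarrow>\<^sub>L 'h. blinfun_apply A (Z x) = Z (blinfun_apply A x)})"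
  have \<C>: "Z \<in> \<C> \<longleftrightarrow> Z \<in> M \<and> (\<forall>x y. inner (Z x) y = inner x (Z y)) \<and>
      (\<forall>A. A o\<^sub>L X = X o\<^sub>L A \<longrightarrow> (\<forall>x. blinfun_apply A (Z x) = Z (blinfun_apply A x)))" for Z
    unfolding \<C>_def by simp
  have "closed \<C>"
    unfolding \<C>_def
    by (intro closed_Int closed_INT ballI closed_Collect_eq continuous_intros closed_algebra)
  moreover have "0 \<in> \<C>"
    by (simp add: \<C>)
  moreover have "(1/2) *\<^sub>R (X + (Z o\<^sub>L Z)) \<in> \<C>" if Z: "Z \<in> \<C>" for Z
  proof -
    have "inner (X x) y = inner x (X y)" for x y
      using X selfadjoint_iff bounded by blast
    moreover have "A (X x) = X (A x)" if "A o\<^sub>L X = X o\<^sub>L A" for A x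
      using that by (metis blinfun_apply_blinfun_compose)
    ultimately show ?thesis
      using Z X(1) by (simp add: \<C> blinfun.bilinear_simps inner_simps)
  qed
  ultimately obtain Y where Y: "Y \<in> \<C>" "norm Y \<le> 1" and fp: "Y = (1/2) *\<^sub>R (X + (Y o\<^sub>L Y))"
    using sqrt_iteration[OF X(3)] by metis
  have YM: "Y \<in> M" and Yadj: "adj Y = Y"
    using Y(1) by (simp_all add: \<C> selfadjoint_iff bounded)
  define S where "S = id_blinfun - Y"
  have "S o\<^sub>L S = id_blinfun - X"
  proof (rule blinfun_eqI)
    fix x
    have "2 *\<^sub>R Y x = X x + Y (Y x)"
      by (subst fp) (simp add: blinfun.bilinear_simps)
    then show "(S o\<^sub>L S) x = (id_blinfun - X) x"
      by (simp add: S_def blinfun.bilinear_simps algebra_simps scaleR_2)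
  qed
  moreover have "0 \<le> inner (S x) x" for x
  proof -
    have "inner (Y x) x \<le> norm (Y x) * norm x"
      by (rule norm_cauchy_schwarz)
    also have "\<dots> \<le> norm x * norm x"
      using order_trans[OF norm_blinfun mult_right_mono[OF Y(2)]] by (intro mult_right_mono) auto
    finally show ?thesis
      by (simp add: S_def blinfun.bilinear_simps inner_simps power2_norm_eq_inner
          flip: power2_eq_square)
  qed
  moreover have "A o\<^sub>L S = S o\<^sub>L A" if "A o\<^sub>L X = X o\<^sub>L A" for A
    using Y(1) that by (intro blinfun_eqI) (simp add: \<C> S_def blinfun.bilinear_simps)
  moreover have "S \<in> M" "adj S = S"
    using YM by (auto simp: S_def adj_diff bounded bounded_ops_intros adj_id Yadj)
  ultimately show ?thesis by blast
qed

lemma norm_one_minus_adj_comp: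
  assumes T: "T \<in> bounded_ops" "norm T \<le> 1"
  shows "norm (id_blinfun - (adj T o\<^sub>L T)) \<le> 1"
proof (rule norm_blinfun_bound)
  fix x
  let ?z = "(adj T o\<^sub>L T) x"
  have "norm ?z \<le> norm (adj T) * norm (T x)"
    using norm_blinfun[of "adj T" "T x"] by simp
  also have "\<dots> \<le> norm (T x)"
    using order_trans[OF norm_adj_le[OF T(1)] T(2)] by (intro mult_left_le_one_le) auto
  finally have "(norm ?z)\<^sup>2 \<le> (norm (T x))\<^sup>2"
    by (intro power_mono) auto
  moreover have "inner ?z x = (norm (T x))\<^sup>2"
    by (simp add: inner_adj'[OF T(1)] power2_norm_eq_inner)
  ultimately have "(norm (x - ?z))\<^sup>2 \<le> (norm x)\<^sup>2"
    using inner_ge_zero[of "T x"] unfolding power2_norm_eq_inner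
    by (smt (verit, best) inner_commute inner_diff_left inner_diff_right)
  then show "norm ((id_blinfun - (adj T o\<^sub>L T)) x) \<le> 1 * norm x"
    by (simp add: blinfun.bilinear_simps)
qed simp

text \<open>
  With \<open>T\<close> scaled to norm \<open>1\<close>, the operator \<open>1 - T\<^sup>* T\<close> is a contraction, so the square root of
  \<open>T\<^sup>* T = 1 - (1 - T\<^sup>* T)\<close> is available.
\<close>

lemma absolute_value:
  assumes T: "T \<in> M"
  shows "\<exists>S\<in>M. adj S = S \<and> S o\<^sub>L S = adj T o\<^sub>L T \<and> (\<forall>x. 0 \<le> inner (S x) x)
    \<and> (\<forall>A. A o\<^sub>L (adj T o\<^sub>L T) = (adj T o\<^sub>L T) o\<^sub>L A \<longrightarrow> A o\<^sub>L S = S o\<^sub>L A)"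
proof (cases "T = 0")
  case True
  then show ?thesis
    using selfadjoint_iff[of 0]
    by (intro bexI[of _ 0]) (auto simp: bounded_ops_intros intro!: blinfun_eqI)
next
  case False
  define r where "r = norm T"
  define R where "R = inverse r *\<^sub>R T"
  have r: "r > 0" using False by (simp add: r_def)
  have RM: "R \<in> M" using T by (simp add: R_def)
  have "norm R \<le> 1" using r by (simp add: R_def r_def)
  have adjR: "adj R = inverse r *\<^sub>R adj T"
    using T by (simp add: R_def scaleR_op adj_scale_op bounded)
  have TR: "adj T o\<^sub>L T = r\<^sup>2 *\<^sub>R (adj R o\<^sub>L R)"
    unfolding adjR unfolding R_def using r
    by (intro blinfun_eqI) (simp add: blinfun.bilinear_simps power2_eq_square field_simps power_inverse)
  define X where "X = id_blinfun - (adj R o\<^sub>L R)"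
  have "norm X \<le> 1"
    unfolding X_def by (rule norm_one_minus_adj_comp) (use RM \<open>norm R \<le> 1\<close> bounded in auto)
  moreover have "X \<in> M" "adj X = X"
    using RM by (auto simp: X_def adj_diff adj_compose adj_adj adj_id bounded bounded_ops_intros
        adj_bounded_ops)
  ultimately obtain S where S: "S \<in> M" "adj S = S" "S o\<^sub>L S = id_blinfun - X"
      "\<And>x. 0 \<le> inner (S x) x" "\<And>A. A o\<^sub>L X = X o\<^sub>L A \<Longrightarrow> A o\<^sub>L S = S o\<^sub>L A"
    using sqrt_one_minus by metis
  have "A o\<^sub>L (r *\<^sub>R S) = (r *\<^sub>R S) o\<^sub>L A"
    if A: "A o\<^sub>L (adj T o\<^sub>L T) = (adj T o\<^sub>L T) o\<^sub>L A" for A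
  proof -
    have "A (adj R (R x)) = adj R (R (A x))" for x
    proof -
      have "(A o\<^sub>L (adj T o\<^sub>L T)) x = ((adj T o\<^sub>L T) o\<^sub>L A) x"
        using A by simp
      then show ?thesis
        using r unfolding TR by (simp add: blinfun.bilinear_simps)
    qed
    then have "A o\<^sub>L X = X o\<^sub>L A"
      by (intro blinfun_eqI) (simp add: X_def blinfun.bilinear_simps)
    then have "A o\<^sub>L S = S o\<^sub>L A" by (rule S(5))
    then show ?thesis
      by (simp add: blinfun_eq_iff blinfun.bilinear_simps)
  qed
  moreover have "(r *\<^sub>R S) o\<^sub>L (r *\<^sub>R S) = adj T o\<^sub>L T"
  proof -
    have "(r *\<^sub>R S) o\<^sub>L (r *\<^sub>R S) = r\<^sup>2 *\<^sub>R (S o\<^sub>L S)"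
      by (intro blinfun_eqI) (simp add: blinfun.bilinear_simps power2_eq_square)
    then show ?thesis by (simp add: S(3) X_def TR)
  qed
  moreover have "adj (r *\<^sub>R S) = r *\<^sub>R S"
    using S(1,2) by (simp add: scaleR_op adj_scale_op bounded)
  moreover have "0 \<le> inner ((r *\<^sub>R S) x) x" for x
    using S(4)[of x] r by (simp add: blinfun.bilinear_simps)
  ultimately show ?thesis
    using scaleR_mem[OF S(1), of r] by blast
qed

text \<open>
  The unitaries are \<open>A \<plusminus> i S\<close> with \<open>S\<close> the square root of \<open>1 - A\<^sup>2\<close>: the points of the unit circle above
  \<open>A\<close>.
\<close>

lemma selfadjoint_contraction_unitary:
  assumes A: "A \<in> M" "adj A = A" "norm A \<le> 1"
  shows "\<exists>U\<in>unitaries M. \<exists>V\<in>unitaries M. U + V = 2 *\<^sub>R A"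
proof -
  define X where "X = A o\<^sub>L A"
  have X: "X \<in> M" "adj X = X"
    using A by (auto simp: X_def adj_compose bounded)
  have "norm X \<le> norm A * norm A"
    unfolding X_def by (rule norm_blinfun_compose)
  also have "\<dots> \<le> 1" using A(3) by (simp add: mult_le_one)
  finally have "norm X \<le> 1" .
  then obtain S where S: "S \<in> M" "adj S = S" "S o\<^sub>L S = id_blinfun - X"
      "\<And>B. B o\<^sub>L X = X o\<^sub>L B \<Longrightarrow> B o\<^sub>L S = S o\<^sub>L B"
    using sqrt_one_minus[OF X] by metis
  have AS: "A o\<^sub>L S = S o\<^sub>L A"
    by (rule S(4)) (rule blinfun_eqI, simp add: X_def)
  have SS: "S (S x) = x - A (A x)" for x
    using arg_cong[OF S(3), of "\<lambda>T. blinfun_apply T x"] by (simp add: X_def blinfun.bilinear_simps)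
  have SA: "S (A x) = A (S x)" for x
    using arg_cong[OF AS, of "\<lambda>T. blinfun_apply T x"] by simp
  have lin: "A (c *\<^sub>C x) = c *\<^sub>C A x" "S (c *\<^sub>C x) = c *\<^sub>C S x" for c x
    using bounded[OF A(1)] bounded[OF S(1)] by (simp_all add: bounded_ops_def)
  define W where "W c = A + scale_op c S" for c
  have W_mem: "W c \<in> M" for c
    using A(1) S(1) by (simp add: W_def)
  have W_adj: "adj (W c) = W (cnj c)" for c
    using A(1,2) S(1,2) by (simp add: W_def adj_add adj_scale_op bounded bounded_ops_intros)
  have WW: "W c o\<^sub>L W (- c) = id_blinfun" if "c * c = - 1" for c
  proof (rule blinfun_eqI)
    fix x
    have cc: "c *\<^sub>C c *\<^sub>C y = - y" for y :: 'h
      using that by (simp add: scaleC_scaleC scaleC_minus_one)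
    have "(W c o\<^sub>L W (- c)) x = A (A x - c *\<^sub>C S x) + c *\<^sub>C S (A x - c *\<^sub>C S x)"
      by (simp add: W_def scale_op.rep_eq blinfun.add_left scaleC_minus_left)
    also have "\<dots> = A (A x) - c *\<^sub>C c *\<^sub>C S (S x)"
      by (simp only: blinfun.diff_right lin SA scaleC_diff_right) simp
    also have "\<dots> = x"
      by (simp only: cc SS) simp
    finally show "(W c o\<^sub>L W (- c)) x = id_blinfun x" by simp
  qed
  have "W \<i> o\<^sub>L W (- \<i>) = id_blinfun" "W (- \<i>) o\<^sub>L W \<i> = id_blinfun"
    using WW[of \<i>] WW[of "- \<i>"] by simp_all
  then have "W \<i> \<in> unitaries M" "W (- \<i>) \<in> unitaries M"
    by (simp_all add: unitaries_def W_mem W_adj)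
  moreover have "W \<i> + W (- \<i>) = 2 *\<^sub>R A"
  proof (rule blinfun_eqI)
    fix x
    show "(W \<i> + W (- \<i>)) x = (2 *\<^sub>R A) x"
      by (simp add: W_def scale_op.rep_eq blinfun.bilinear_simps scaleR_2
          scaleC_minus_left)
  qed
  ultimately show ?thesis by blast
qed

end

section \<open>Orthogonal projections and spectral projections\<close>

text \<open>
  By the parallelogram law a minimizing sequence of distances is Cauchy; its limit is the nearest
  point, and varying it along \<open>K\<close> gives orthogonality.
\<close>

lemma nearest_point_subspace:
  fixes K :: "'a::{real_inner, complete_space} set"
  assumes K: "subspace K" "closed K"
  shows "\<exists>k\<in>K. \<forall>z\<in>K. inner (x - k) z = 0"
proof -
  define J where "J k = (norm (x - k))\<^sup>2" for k
  define m where "m = Inf (J ` K)"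
  have ne: "J ` K \<noteq> {}" and bdd: "bdd_below (J ` K)"
    using subspace_0[OF K(1)] by (auto simp: J_def intro!: bdd_belowI[of _ 0])
  have m_le: "m \<le> J k" if "k \<in> K" for k
    unfolding m_def using that bdd by (intro cInf_lower) auto
  have "\<exists>k\<in>K. J k < m + 1 / real (Suc n)" for n
    using cInf_less_iff[OF ne bdd, of "m + 1 / real (Suc n)"] by (auto simp: m_def)
  then obtain X where X: "\<And>n. X n \<in> K" "\<And>n. J (X n) < m + 1 / real (Suc n)"
    by metis
  have par: "(norm (k - l))\<^sup>2 = 2 * J k + 2 * J l - 4 * J ((1/2) *\<^sub>R (k + l))" for k l
    by (simp add: J_def power2_norm_eq_inner inner_simps inner_commute algebra_simps)
  have close: "(norm (X i - X j))\<^sup>2 < 4 / real (Suc n)" if "n \<le> i" "n \<le> j" for n i j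
  proof -
    have "1 / real (Suc i) \<le> 1 / real (Suc n)" "1 / real (Suc j) \<le> 1 / real (Suc n)"
      using that by (auto intro!: divide_left_mono)
    moreover have "m \<le> J ((1/2) *\<^sub>R (X i + X j))"
      using X(1) K(1) by (intro m_le) (simp add: subspace_add subspace_scale)
    ultimately show ?thesis
      using par[of "X i" "X j"] X(2)[of i] X(2)[of j] by argo
  qed
  have "Cauchy X"
  proof (rule CauchyI)
    fix e :: real assume "0 < e"
    then obtain n where n: "4 / e\<^sup>2 < real n"
      using reals_Archimedean2 by blast
    have "(norm (X i - X j))\<^sup>2 < e\<^sup>2" if "n \<le> i" "n \<le> j" for i j
    proof -
      have "4 / real (Suc n) \<le> e\<^sup>2"
        using n \<open>0 < e\<close> by (simp add: field_simps add_strict_increasing2 less_imp_le)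
      then show ?thesis using close[OF that] by linarith
    qed
    then show "\<exists>M. \<forall>i\<ge>M. \<forall>j\<ge>M. norm (X i - X j) < e"
      using \<open>0 < e\<close> by (meson less_imp_le power_less_imp_less_base)
  qed
  then obtain k where k: "X \<longlonglongrightarrow> k"
    using Cauchy_convergent convergent_def by blast
  have kK: "k \<in> K"
    by (rule closed_sequentially[OF K(2) _ k]) (rule X)
  have "(\<lambda>n. J (X n)) \<longlonglongrightarrow> J k"
    unfolding J_def by (intro tendsto_intros k)
  moreover have "(\<lambda>n. m + 1 / real (Suc n)) \<longlonglongrightarrow> m + 0"
    using LIMSEQ_inverse_real_of_nat by (intro tendsto_intros) (simp add: inverse_eq_divide)
  ultimately have "J k \<le> m + 0"
    by (rule LIMSEQ_le) (use X(2) less_imp_le in blast)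
  then have min: "J k \<le> J (k + t *\<^sub>R z)" if "z \<in> K" for t z
    using m_le[of "k + t *\<^sub>R z"] that kK K(1) by (simp add: subspace_add subspace_scale)
  have "inner (x - k) z = 0" if z: "z \<in> K" for z
  proof -
    define b where "b = inner (x - k) z"
    define q where "q = (norm z)\<^sup>2 + 1"
    have q: "0 < q" "(norm z)\<^sup>2 \<le> q"
      unfolding q_def by (auto simp: add_nonneg_pos)
    have "J (k + t *\<^sub>R z) = J k - 2 * t * b + t\<^sup>2 * (norm z)\<^sup>2" for t
      unfolding J_def b_def power2_norm_eq_inner
      by (simp add: inner_simps inner_commute algebra_simps power2_eq_square[of t])
    \<comment> \<open>The step \<open>b / \<parallel>z\<parallel>\<^sup>2\<close> would be optimal; adding \<open>1\<close> to the denominator avoids division by zero.\<close>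
    from this[of "b / q"] min[OF z, of "b / q"]
    have "0 \<le> - 2 * (b / q) * b + (b / q)\<^sup>2 * q"
      using mult_left_mono[OF q(2), of "(b / q)\<^sup>2"] by simp
    also have "\<dots> = - (b\<^sup>2 / q)"
      using q by (simp add: power2_eq_square field_simps)
    finally show ?thesis
      using q by (simp add: b_def divide_le_0_iff)
  qed
  with kK show ?thesis by blast
qed

definition orth_proj :: "'a::real_inner set \<Rightarrow> ('a \<Rightarrow>\<^sub>L 'a)" where
  "orth_proj K = (SOME P :: 'a \<Rightarrow>\<^sub>L 'a. \<forall>x. P x \<in> K \<and> (\<forall>z\<in>K. inner (x - P x) z = 0))"

context
  fixes K :: "'a::{real_inner, complete_space} set"
  assumes K: "subspace K" "closed K"
begin

lemma orthogonal_decomposition_unique: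
  assumes "k \<in> K" "\<And>z. z \<in> K \<Longrightarrow> inner (x - k) z = 0"
    and "l \<in> K" "\<And>z. z \<in> K \<Longrightarrow> inner (x - l) z = 0"
  shows "k = l"
proof -
  have "k - l \<in> K" using assms K by (simp add: subspace_diff)
  then have "inner (x - l) (k - l) - inner (x - k) (k - l) = 0"
    using assms by simp
  then have "inner (k - l) (k - l) = 0"
    by (simp flip: inner_diff_left)
  then show ?thesis by simp
qed

lemma orth_proj: "orth_proj K x \<in> K" "z \<in> K \<Longrightarrow> inner (x - orth_proj K x) z = 0"
proof -
  obtain p where p: "\<And>x. p x \<in> K" "\<And>x z. z \<in> K \<Longrightarrow> inner (x - p x) z = 0"
    using nearest_point_subspace[OF K] by metis
  have pI: "p x = k" if "k \<in> K" "\<And>z. z \<in> K \<Longrightarrow> inner (x - k) z = 0" for x k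
    by (rule orthogonal_decomposition_unique[of "p x" x]) (use p that in auto)
  have "bounded_linear p"
  proof (rule bounded_linear_intro)
    show "p (x + y) = p x + p y" for x y
    proof (rule pI)
      show "inner (x + y - (p x + p y)) z = 0" if "z \<in> K" for z
        using p(2)[OF that, of x] p(2)[OF that, of y] by (simp add: inner_simps)
    qed (use p K subspace_add in blast)
    show "p (r *\<^sub>R x) = r *\<^sub>R p x" for r x
    proof (rule pI)
      show "inner (r *\<^sub>R x - r *\<^sub>R p x) z = 0" if "z \<in> K" for z
        using p(2)[OF that, of x] by (simp flip: scaleR_diff_right)
    qed (use p K subspace_scale in blast)
    show "norm (p x) \<le> norm x * 1" for x
    proof (cases "p x = 0")
      case False
      have "norm (p x) * norm (p x) = inner x (p x)"
        using p(2)[OF p(1)[of x], of x] by (simp add: inner_simps power2_norm_eq_inner flip: power2_eq_square)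
      also have "\<dots> \<le> norm x * norm (p x)"
        by (rule norm_cauchy_schwarz)
      finally show ?thesis using False by simp
    qed simp
  qed
  then have "blinfun_apply (Blinfun p) = p"
    by (rule bounded_linear_Blinfun_apply)
  then have "\<exists>P :: 'a \<Rightarrow>\<^sub>L 'a. \<forall>x. P x \<in> K \<and> (\<forall>z\<in>K. inner (x - P x) z = 0)"
    using p by metis
  then have "\<forall>x. orth_proj K x \<in> K \<and> (\<forall>z\<in>K. inner (x - orth_proj K x) z = 0)"
    unfolding orth_proj_def by (rule someI_ex)
  then show "orth_proj K x \<in> K" "z \<in> K \<Longrightarrow> inner (x - orth_proj K x) z = 0"
    by blast+
qed

lemma orth_proj_eqI: "k \<in> K \<Longrightarrow> (\<And>z. z \<in> K \<Longrightarrow> inner (x - k) z = 0) \<Longrightarrow> orth_proj K x = k"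
  by (rule orthogonal_decomposition_unique) (auto intro: orth_proj)

lemma orth_proj_fixes: "x \<in> K \<Longrightarrow> orth_proj K x = x"
  by (rule orth_proj_eqI) auto

lemma orth_proj_fixes_iff: "orth_proj K x = x \<longleftrightarrow> x \<in> K"
  using orth_proj_fixes orth_proj(1)[of x] by metis

lemma orth_proj_zero_iff: "orth_proj K x = 0 \<longleftrightarrow> (\<forall>z\<in>K. inner x z = 0)"
  using orth_proj(2)[of _ x] orth_proj_eqI[of 0 x] subspace_0[OF K(1)] by fastforce

lemma orth_proj_selfadjoint: "inner (orth_proj K x) y = inner x (orth_proj K y)"
  using orth_proj(2)[OF orth_proj(1)[of y], of x] orth_proj(2)[OF orth_proj(1)[of x], of y]
  by (simp add: inner_simps inner_commute)

end

lemma orth_proj_commutes: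
  fixes K :: "'h::chilbert_space set"
  assumes K: "subspace K" "closed K" and S: "S \<in> bounded_ops"
    and "\<And>x. x \<in> K \<Longrightarrow> S x \<in> K" "\<And>x. x \<in> K \<Longrightarrow> adj S x \<in> K"
  shows "orth_proj K (S x) = S (orth_proj K x)"
proof (rule orth_proj_eqI[OF K])
  show "S (orth_proj K x) \<in> K"
    using assms orth_proj(1)[OF K] by blast
  show "inner (S x - S (orth_proj K x)) z = 0" if "z \<in> K" for z
    using orth_proj(2)[OF K, of "adj S z" x] assms that
    by (simp add: inner_adj flip: blinfun.diff_right)
qed

lemma projections_iff:
  assumes "E \<in> bounded_ops"
  shows "E \<in> projections M \<longleftrightarrow> E \<in> M \<and> (\<forall>x y. inner (E x) y = inner x (E y)) \<and> (\<forall>x. E (E x) = E x)"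
  using assms using blinfun_eq_iff[of "E o\<^sub>L E" E] by (simp add: projections_def selfadjoint_iff)

context von_neumann
begin

lemma projD:
  assumes "E \<in> projections M"
  shows "E \<in> M" "E \<in> bounded_ops" "adj E = E" "E o\<^sub>L E = E" "E (E x) = E x"
    "inner (E x) y = inner x (E y)"
  using assms projections_iff[of E M] bounded[of E] by (auto simp: projections_def)

lemma projI:
  assumes "E \<in> M" "\<And>x y. inner (E x) y = inner x (E y)" "\<And>x. E (E x) = E x"
  shows "E \<in> projections M"
  using assms projections_iff[of E M] bounded[of E] by auto

lemma proj_norm_sq: "E \<in> projections M \<Longrightarrow> inner (E x) x = (norm (E x))\<^sup>2"
  by (metis power2_norm_eq_inner projD(5,6))

lemma proj_norm_apply_le:
  assumes E: "E \<in> projections M"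
  shows "norm (E x) \<le> norm x"
proof (cases "E x = 0")
  case False
  have "norm (E x) * norm (E x) \<le> norm (E x) * norm x"
    using norm_cauchy_schwarz[of "E x" x] proj_norm_sq[OF E, of x] by (simp add: power2_eq_square)
  then show ?thesis using False by simp
qed simp

lemma proj_norm_le: "E \<in> projections M \<Longrightarrow> norm E \<le> 1"
  by (rule norm_blinfun_bound) (auto simp: proj_norm_apply_le)

lemma id_proj [simp]: "id_blinfun \<in> projections M"
  by (auto intro!: projI)

text \<open>
  The source of all projections below: a closed subspace invariant under the commutant is the range
  of a projection in the algebra. Invariance suffices since the commutant is closed under adjoints.
\<close>

lemma orth_proj_in:
  assumes K: "subspace K" "closed K" and inv: "\<And>S x. S \<in> commutant M \<Longrightarrow> x \<in> K \<Longrightarrow> S x \<in> K"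
  shows "orth_proj K \<in> projections M"
proof (rule projI)
  have *: "orth_proj K (S x) = S (orth_proj K x)" if "S \<in> commutant M" for S x
    using that by (intro orth_proj_commutes[OF K]) (auto simp: inv adj_commutant commutant_bounded)
  have "orth_proj K (c *\<^sub>C x) = c *\<^sub>C orth_proj K x" for c x
    using *[OF scale_id_commutant[of c], of x] by (simp add: scale_op.rep_eq)
  then show "orth_proj K \<in> M"
    using * by (simp add: mem_iff bounded_ops_def)
  show "inner (orth_proj K x) y = inner x (orth_proj K y)" for x y
    by (rule orth_proj_selfadjoint[OF K])
  show "orth_proj K (orth_proj K x) = orth_proj K x" for x
    by (simp add: orth_proj_fixes[OF K] orth_proj(1)[OF K])
qed

text \<open>
  With \<open>Y = T\<^sup>* T - \<mu>\<^sup>2\<close> and \<open>A = |Y|\<close>, let \<open>Q\<close> project onto the kernel of \<open>A - Y\<close>. There \<open>Y = A \<ge> 0\<close>, that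
  is \<open>\<parallel>T x\<parallel> \<ge> \<mu> \<parallel>x\<parallel>\<close>. As \<open>(A - Y)(A + Y) = A\<^sup>2 - Y\<^sup>2 = 0\<close>, the kernel contains the range of \<open>A + Y\<close>; so
  \<open>A + Y\<close> vanishes on the orthogonal complement, where therefore \<open>Y = - A \<le> 0\<close>.
\<close>

lemma spectral_projection:
  assumes T: "T \<in> M" and \<mu>: "0 \<le> \<mu>"
  shows "\<exists>Q\<in>projections M. (\<forall>x. Q x = x \<longrightarrow> \<mu> * norm x \<le> norm (T x))
    \<and> (\<forall>x. Q x = 0 \<longrightarrow> norm (T x) \<le> \<mu> * norm x)"
proof -
  define Y where "Y = (adj T o\<^sub>L T) - \<mu>\<^sup>2 *\<^sub>R id_blinfun"
  have YM: "Y \<in> M" using T by (simp add: Y_def)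
  have Yadj: "adj Y = Y"
    using T by (simp add: Y_def adj_diff adj_compose adj_adj scaleR_op adj_scale_op bounded
        bounded_ops_intros adj_bounded_ops adj_id)
  have Y_inner: "inner (Y x) x = (norm (T x))\<^sup>2 - \<mu>\<^sup>2 * (norm x)\<^sup>2" for x
    by (simp add: Y_def blinfun.bilinear_simps inner_simps inner_adj'[OF bounded[OF T]]
        power2_norm_eq_inner)
  obtain A where A: "A \<in> M" "adj A = A" "A o\<^sub>L A = Y o\<^sub>L Y" "\<And>x. 0 \<le> inner (A x) x"
    and "Y o\<^sub>L (Y o\<^sub>L Y) = (Y o\<^sub>L Y) o\<^sub>L Y \<longrightarrow> Y o\<^sub>L A = A o\<^sub>L Y"
    using absolute_value[OF YM] unfolding Yadj by metis
  then have YA: "Y o\<^sub>L A = A o\<^sub>L Y"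
    by (simp add: blinfun_eq_iff)
  define K where "K = {x. A x = Y x}"
  have K: "subspace K" "closed K"
    unfolding K_def
    by (auto simp: subspace_def blinfun.bilinear_simps intro!: closed_Collect_eq continuous_intros)
  have "S x \<in> K" if "S \<in> commutant M" "x \<in> K" for S x
    using that by (simp add: K_def commute[OF A(1)] commute[OF YM])
  then have Q: "orth_proj K \<in> projections M"
    using orth_proj_in[OF K] by blast
  have "\<mu> * norm x \<le> norm (T x)" if "orth_proj K x = x" for x
  proof -
    have "A x = Y x"
      using that orth_proj_fixes_iff[OF K, of x] unfolding K_def by simp
    then have "(\<mu> * norm x)\<^sup>2 \<le> (norm (T x))\<^sup>2"
      using A(4)[of x] Y_inner[of x] by (simp add: power_mult_distrib)
    then show ?thesis
      by (rule power2_le_imp_le) simp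
  qed
  moreover have "norm (T x) \<le> \<mu> * norm x" if x: "orth_proj K x = 0" for x
  proof -
    have "A w + Y w \<in> K" for w
    proof -
      have "A (A w) = Y (Y w)" "Y (A w) = A (Y w)"
        using arg_cong[OF A(3), of "\<lambda>T. blinfun_apply T w"]
          arg_cong[OF YA, of "\<lambda>T. blinfun_apply T w"] by simp_all
      then show ?thesis by (simp add: K_def blinfun.add_right)
    qed
    then have "inner x (A w + Y w) = 0" for w
      using x orth_proj_zero_iff[OF K] by blast
    moreover have "inner x (A w + Y w) = inner (A x + Y x) w" for w
      using inner_adj[OF bounded[OF A(1)], of x w] inner_adj[OF bounded[OF YM], of x w]
      by (simp add: A(2) Yadj inner_simps)
    ultimately have "inner (A x + Y x) (A x + Y x) = 0"
      by metis
    then have "Y x = - A x"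
      by (simp add: eq_neg_iff_add_eq_0 add.commute)
    then have "(norm (T x))\<^sup>2 \<le> (\<mu> * norm x)\<^sup>2"
      using A(4)[of x] Y_inner[of x] by (simp add: power_mult_distrib)
    then show ?thesis
      by (rule power2_le_imp_le) (use \<mu> in simp)
  qed
  ultimately show ?thesis
    using Q by blast
qed

section \<open>Inverses in the algebra\<close>

text \<open>
  The argument of Lax and Milgram: for small \<open>c > 0\<close> the operator \<open>1 - c B\<close> has norm less than \<open>1\<close>, and
  the right inverse of \<open>B\<close> is the fixed point of the contraction \<open>Z \<mapsto> c + (1 - c B) Z\<close> of the norm
  closed algebra. Coercivity makes \<open>B\<close> injective, so the inverse is two-sided.
\<close>

lemma coercive_inverse:
  assumes B: "B \<in> M" and m: "0 < m" and coercive: "\<And>x. m * (norm x)\<^sup>2 \<le> inner (B x) x"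
  shows "\<exists>Z\<in>M. Z o\<^sub>L B = id_blinfun \<and> norm Z \<le> 1 / m"
proof -
  define k where "k = norm B + m"
  have k: "0 < k" "m \<le> k" "norm B \<le> k"
    using m by (auto simp: k_def add_nonneg_pos)
  \<comment> \<open>This \<open>c\<close> minimizes the bound \<open>1 - 2 c m + c\<^sup>2 k\<^sup>2\<close> for \<open>\<parallel>1 - c B\<parallel>\<^sup>2\<close>; the minimum is \<open>q\<close>.\<close>
  define c where "c = m / k\<^sup>2"
  define q where "q = 1 - (m / k)\<^sup>2"
  have q: "0 \<le> q" "q < 1"
    using m k by (auto simp: q_def power_le_one_iff)
  define D where "D = id_blinfun - c *\<^sub>R B"
  have "(norm (D x))\<^sup>2 \<le> q * (norm x)\<^sup>2" for x
  proof -
    have "(norm (D x))\<^sup>2 = (norm x)\<^sup>2 - 2 * c * inner (B x) x + c\<^sup>2 * (norm (B x))\<^sup>2"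
      by (simp add: D_def blinfun.bilinear_simps power2_norm_eq_inner inner_simps inner_commute
          power2_eq_square[of c] algebra_simps)
    also have "\<dots> \<le> (norm x)\<^sup>2 - 2 * c * (m * (norm x)\<^sup>2) + c\<^sup>2 * (k * norm x)\<^sup>2"
    proof -
      have "norm (B x) \<le> k * norm x"
        by (rule order_trans[OF norm_blinfun mult_right_mono[OF k(3)]]) simp
      then have "c\<^sup>2 * (norm (B x))\<^sup>2 \<le> c\<^sup>2 * (k * norm x)\<^sup>2"
        by (intro mult_left_mono power_mono) auto
      moreover have "2 * c * (m * (norm x)\<^sup>2) \<le> 2 * c * inner (B x) x"
        using m by (intro mult_left_mono coercive) (simp add: c_def)
      ultimately show ?thesis by linarith
    qed
    also have "\<dots> = q * (norm x)\<^sup>2"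
      using k by (simp add: c_def q_def field_simps power2_eq_square)
    finally show ?thesis .
  qed
  then have D_le: "norm (D x) \<le> sqrt q * norm x" for x
    by (metis norm_ge_zero real_le_rsqrt real_sqrt_mult real_sqrt_abs abs_norm_cancel)
  then have normD: "norm D \<le> sqrt q"
    using q by (intro norm_blinfun_bound) auto
  define F where "F Z = c *\<^sub>R id_blinfun + (D o\<^sub>L Z)" for Z
  have "\<exists>!Z. Z \<in> M \<and> F Z = Z"
  proof (rule Banach_fix[of M "sqrt q"])
    show "complete M"
      using closed_algebra by (rule complete_eq_closed[THEN iffD2])
    show "M \<noteq> {}" using id_mem by blast
    show "0 \<le> sqrt q" "sqrt q < 1" using q by auto
    show "F ` M \<subseteq> M"
      using B by (auto simp: F_def D_def)
    show "dist (F Y) (F Z) \<le> sqrt q * dist Y Z" if "Y \<in> M" "Z \<in> M" for Y Z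
    proof -
      have "F Y - F Z = D o\<^sub>L (Y - Z)"
        by (rule blinfun_eqI) (simp add: F_def blinfun.bilinear_simps)
      then have "dist (F Y) (F Z) \<le> norm D * norm (Y - Z)"
        by (simp add: dist_norm norm_blinfun_compose)
      also have "\<dots> \<le> sqrt q * dist Y Z"
        using normD by (simp add: dist_norm mult_right_mono)
      finally show ?thesis .
    qed
  qed
  then obtain Z where Z: "Z \<in> M" "F Z = Z" by blast
  have c: "c \<noteq> 0" using m k by (simp add: c_def)
  have BZ: "B (Z x) = x" for x
  proof -
    have "Z x = c *\<^sub>R x + Z x - c *\<^sub>R B (Z x)"
      by (subst (1) Z(2)[symmetric]) (simp add: F_def D_def blinfun.bilinear_simps)
    then show ?thesis using c by simp
  qed
  have inj: "x = 0" if "B x = 0" for x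
    using coercive[of x] m that by (simp add: mult_le_0_iff)
  have "Z (B x) = x" for x
    using inj[of "Z (B x) - x"] by (simp add: blinfun.diff_right BZ)
  then have "Z o\<^sub>L B = id_blinfun"
    by (intro blinfun_eqI) simp
  moreover have "norm Z \<le> 1 / m"
  proof (rule norm_blinfun_bound)
    fix y
    have "m * norm (Z y) * norm (Z y) \<le> inner (B (Z y)) (Z y)"
      using coercive[of "Z y"] by (simp add: power2_eq_square)
    also have "\<dots> \<le> norm y * norm (Z y)"
      unfolding BZ by (rule norm_cauchy_schwarz)
    finally have "m * norm (Z y) \<le> norm y"
      by (cases "Z y = 0") simp_all
    then show "norm (Z y) \<le> 1 / m * norm y"
      using m by (simp add: field_simps)
  qed (use m in simp)
  ultimately show ?thesis using Z(1) by blast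
qed

text \<open>
  The operator \<open>Q T\<^sup>* T Q + \<mu>\<^sup>2 (1 - Q)\<close> is coercive with constant \<open>\<mu>\<^sup>2\<close> and agrees with \<open>Q T\<^sup>* T Q\<close> on the
  range of \<open>Q\<close>; so its inverse composed with \<open>Q T\<^sup>*\<close> undoes \<open>T\<close> there.
\<close>

lemma left_inverse_on_projection:
  assumes T: "T \<in> M" and Q: "Q \<in> projections M" and \<mu>: "0 < \<mu>"
    and below: "\<And>x. Q x = x \<Longrightarrow> \<mu> * norm x \<le> norm (T x)"
  shows "\<exists>Z\<in>M. norm Z \<le> norm T / \<mu>\<^sup>2 \<and> Z o\<^sub>L (T o\<^sub>L Q) = Q"
proof -
  define B where "B = (Q o\<^sub>L (adj T o\<^sub>L (T o\<^sub>L Q))) + \<mu>\<^sup>2 *\<^sub>R (id_blinfun - Q)"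
  have B: "B \<in> M" using T projD(1)[OF Q] by (simp add: B_def)
  have coercive: "\<mu>\<^sup>2 * (norm x)\<^sup>2 \<le> inner (B x) x" for x
  proof -
    have "inner (B x) x = (norm (T (Q x)))\<^sup>2 + \<mu>\<^sup>2 * ((norm x)\<^sup>2 - (norm (Q x))\<^sup>2)"
      by (simp add: B_def blinfun.bilinear_simps inner_simps projD(6)[OF Q] proj_norm_sq[OF Q]
          inner_adj'[OF bounded[OF T]] flip: power2_norm_eq_inner)
        (simp add: proj_norm_sq[OF Q] flip: projD(6)[OF Q])
    moreover have "(\<mu> * norm (Q x))\<^sup>2 \<le> (norm (T (Q x)))\<^sup>2"
      using below[of "Q x"] projD(5)[OF Q] \<mu> by (intro power_mono) auto
    ultimately show ?thesis
      by (simp add: power_mult_distrib algebra_simps)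
  qed
  obtain Y where Y: "Y \<in> M" "Y o\<^sub>L B = id_blinfun" "norm Y \<le> 1 / \<mu>\<^sup>2"
    using coercive_inverse[OF B _ coercive] \<mu> by auto
  define Z where "Z = Y o\<^sub>L (Q o\<^sub>L adj T)"
  have "Z \<in> M" using Y T projD(1)[OF Q] by (simp add: Z_def)
  moreover have "norm Z \<le> norm T / \<mu>\<^sup>2"
  proof -
    have "norm (Q o\<^sub>L adj T) \<le> 1 * norm T"
      by (rule order_trans[OF norm_blinfun_compose mult_mono])
        (use proj_norm_le[OF Q] norm_adj_le[OF bounded[OF T]] in auto)
    then have "norm Z \<le> (1 / \<mu>\<^sup>2) * (1 * norm T)"
      unfolding Z_def by (rule order_trans[OF norm_blinfun_compose mult_mono'[OF Y(3)]]) auto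
    then show ?thesis by simp
  qed
  moreover have "Z o\<^sub>L (T o\<^sub>L Q) = Q"
  proof (rule blinfun_eqI)
    fix x
    have "Y (B (Q x)) = Q x"
      using arg_cong[OF Y(2), of "\<lambda>T. blinfun_apply T (Q x)"] by simp
    then show "(Z o\<^sub>L (T o\<^sub>L Q)) x = Q x"
      by (simp add: B_def Z_def blinfun.bilinear_simps projD(5)[OF Q])
  qed
  ultimately show ?thesis by blast
qed

end

section \<open>Partial isometries from their graphs\<close>

lemma subspace_closure:
  fixes K :: "'a::real_normed_vector set"
  assumes "subspace K"
  shows "subspace (closure K)"
  unfolding subspace_def
proof (intro conjI ballI allI)
  show "0 \<in> closure K"
    using subspace_0[OF assms] closure_subset by blast
  fix x assume "x \<in> closure K"
  then obtain f where f: "\<And>n. f n \<in> K" "f \<longlonglongrightarrow> x"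
    unfolding closure_sequential by blast
  show "c *\<^sub>R x \<in> closure K" for c
    unfolding closure_sequential using f assms
    by (intro exI[of _ "\<lambda>n. c *\<^sub>R f n"]) (auto intro!: tendsto_intros subspace_scale)
  fix y assume "y \<in> closure K"
  then obtain g where g: "\<And>n. g n \<in> K" "g \<longlonglongrightarrow> y"
    unfolding closure_sequential by blast
  show "x + y \<in> closure K"
    unfolding closure_sequential using f g assms
    by (intro exI[of _ "\<lambda>n. f n + g n"]) (auto intro!: tendsto_intros subspace_add)
qed

context von_neumann
begin

text \<open>
  The closure of such a \<open>G\<close> is the graph, over its initial space, of a partial isometry in the algebra.
  Allowing graphs that are not closed keeps unions of chains and sums of graphs in the class.
\<close>

definition isometric_graph :: "('h \<times> 'h) set \<Rightarrow> bool" where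
  "isometric_graph G \<longleftrightarrow> subspace G \<and> (\<forall>(x, y)\<in>G. norm x = norm y)
     \<and> (\<forall>S\<in>commutant M. \<forall>(x, y)\<in>G. (S x, S y) \<in> G)"

lemma isometric_graphD:
  assumes "isometric_graph G"
  shows "subspace G" "(x, y) \<in> G \<Longrightarrow> norm x = norm y"
    "S \<in> commutant M \<Longrightarrow> (x, y) \<in> G \<Longrightarrow> (S x, S y) \<in> G"
  using assms by (auto simp: isometric_graph_def)

lemma isometric_graph_closure:
  assumes G: "isometric_graph G"
  shows "isometric_graph (closure G)"
  unfolding isometric_graph_def
proof (intro conjI ballI)
  show "subspace (closure G)"
    by (rule subspace_closure[OF isometric_graphD(1)[OF G]])
  have "closed {p :: 'h \<times> 'h. norm (fst p) = norm (snd p)}"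
    by (intro closed_Collect_eq continuous_intros)
  then have "closure G \<subseteq> {p. norm (fst p) = norm (snd p)}"
    by (rule closure_minimal[rotated]) (use isometric_graphD(2)[OF G] in auto)
  then show "case p of (x, y) \<Rightarrow> norm x = norm y" if "p \<in> closure G" for p
    using that by auto
  fix S p assume S: "S \<in> commutant M" and p: "p \<in> closure G"
  have "(\<lambda>p. (S (fst p), S (snd p))) ` closure G \<subseteq> closure G"
    by (rule image_closure_subset)
      (use isometric_graphD(3)[OF G S] closure_subset[of G] in
        \<open>auto intro!: continuous_intros simp: subset_iff\<close>)
  then show "case p of (x, y) \<Rightarrow> (S x, S y) \<in> closure G"
    using p by (auto simp: split_beta)
qed

lemma closed_isometric_graph_domain:
  assumes G: "isometric_graph G" "closed G"
  shows "closed (fst ` G)"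
  unfolding closed_sequential_limits
proof (intro allI impI, elim conjE)
  fix f x assume f: "\<forall>n. f n \<in> fst ` G" and lim: "f \<longlonglongrightarrow> x"
  from f have "\<forall>n. \<exists>y. (f n, y) \<in> G" by force
  then obtain g where g: "\<And>n. (f n, g n) \<in> G" by metis
  have "(f m - f n, g m - g n) \<in> G" for m n
    using subspace_diff[OF isometric_graphD(1)[OF G(1)] g[of m] g[of n]] by simp
  then have "norm (g m - g n) = norm (f m - f n)" for m n
    using isometric_graphD(2)[OF G(1)] by metis
  moreover have "Cauchy f"
    using lim by (rule LIMSEQ_imp_Cauchy)
  ultimately have "Cauchy g"
    by (simp add: Cauchy_def dist_norm)
  then obtain y where "g \<longlonglongrightarrow> y"
    using Cauchy_convergent convergent_def by blast
  then have "(\<lambda>n. (f n, g n)) \<longlonglongrightarrow> (x, y)"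
    using lim by (intro tendsto_intros)
  then have "(x, y) \<in> G"
    by (rule closed_sequentially[OF G(2) g])
  then show "x \<in> fst ` G" by force
qed

text \<open>
  The closure of \<open>G\<close> is the graph of an isometry between closed subspaces; precomposing it with the
  projection onto its domain gives an operator that commutes with the commutant, since the graph is
  invariant under the commutant.
\<close>

lemma partial_isometry_of_graph:
  assumes G: "isometric_graph G"
  defines "P \<equiv> orth_proj (closure (fst ` G))" and "R \<equiv> orth_proj (closure (snd ` G))"
  shows "\<exists>V\<in>M. adj V o\<^sub>L V = P \<and> V o\<^sub>L adj V = R \<and> V o\<^sub>L P = V \<and> R o\<^sub>L V = V
    \<and> norm V \<le> 1
    \<and> P \<in> projections M \<and> R \<in> projections M"
proof -
  define H where "H = closure G"
  define D where "D = closure (fst ` G)"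
  define L where "L = closure (snd ` G)"
  have lin: "linear (fst :: 'h \<times> 'h \<Rightarrow> 'h)" "linear (snd :: 'h \<times> 'h \<Rightarrow> 'h)"
    by (auto intro!: linearI)
  have D: "subspace D" "closed D" and L: "subspace L" "closed L"
    unfolding D_def L_def
    by (auto intro!: subspace_closure linear_subspace_image lin isometric_graphD(1)[OF G])
  have H: "isometric_graph H"
    unfolding H_def by (rule isometric_graph_closure[OF G])
  have "closed (fst ` H)"
    unfolding H_def by (intro closed_isometric_graph_domain isometric_graph_closure G) simp
  then have DH: "D \<subseteq> fst ` H"
    unfolding D_def H_def by (intro closure_minimal image_mono closure_subset)
  have HL: "y \<in> L" if "(x, y) \<in> H" for x y
  proof -
    have "snd ` closure G \<subseteq> L"
      unfolding L_def by (rule image_closure_subset) (auto intro!: continuous_intros closure_subset)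
    then show ?thesis using that unfolding H_def by force
  qed
  have inv_fst: "S ` (fst ` G) \<subseteq> fst ` G" and inv_snd: "S ` (snd ` G) \<subseteq> snd ` G"
    if "S \<in> commutant M" for S
    using isometric_graphD(3)[OF G that] by force+
  have inv_closure: "S x \<in> closure A" if "S ` A \<subseteq> A" "x \<in> closure A" for S :: "'h \<Rightarrow>\<^sub>L 'h" and A x
  proof -
    have "S ` closure A \<subseteq> closure A"
      by (rule image_closure_subset)
        (use that(1) closure_subset in \<open>auto intro!: continuous_intros\<close>)
    then show ?thesis using that(2) by blast
  qed
  have P: "P \<in> projections M"
    using orth_proj_in[OF D] inv_closure[OF inv_fst] by (auto simp: P_def D_def)
  have R: "R \<in> projections M"
    using orth_proj_in[OF L] inv_closure[OF inv_snd] by (auto simp: R_def L_def)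
  have uniq: "y = z" if "(x, y) \<in> H" "(x, z) \<in> H" for x y z
  proof -
    have "(0, y - z) \<in> H"
      using subspace_diff[OF isometric_graphD(1)[OF H] that] by simp
    then show ?thesis
      using isometric_graphD(2)[OF H] by fastforce
  qed
  have "\<forall>x. \<exists>y. (P x, y) \<in> H"
  proof
    fix x
    have "P x \<in> fst ` H"
      using DH orth_proj(1)[OF D, of x] by (auto simp: P_def D_def)
    then show "\<exists>y. (P x, y) \<in> H" by force
  qed
  then obtain v where v: "\<And>x. (P x, v x) \<in> H" by metis
  have norm_v: "norm (v x) = norm (P x)" for x
    using isometric_graphD(2)[OF H v] by simp
  have "bounded_linear v"
  proof (rule bounded_linear_intro)
    show "v (x + y) = v x + v y" for x y
      by (rule uniq[OF v]) (use subspace_add[OF isometric_graphD(1)[OF H] v[of x] v[of y]] in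
          \<open>simp add: blinfun.add_right\<close>)
    show "v (r *\<^sub>R x) = r *\<^sub>R v x" for r x
      by (rule uniq[OF v]) (use subspace_scale[OF isometric_graphD(1)[OF H] v[of x], of r] in
          \<open>simp add: blinfun.scaleR_right\<close>)
    show "norm (v x) \<le> norm x * 1" for x
      using proj_norm_apply_le[OF P] by (simp add: norm_v)
  qed
  then obtain V :: "'h \<Rightarrow>\<^sub>L 'h" where V: "blinfun_apply V = v"
    using bounded_linear_Blinfun_apply by blast
  have comm: "V (S x) = S (V x)" if S: "S \<in> commutant M" for S x
  proof -
    have "P (S x) = S (P x)" by (rule commute[OF projD(1)[OF P] S])
    then show ?thesis
      using uniq[OF v[of "S x"]] isometric_graphD(3)[OF H S v[of x]] by (simp add: V)
  qed
  have "V (c *\<^sub>C x) = c *\<^sub>C V x" for c x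
    using comm[OF scale_id_commutant[of c], of x] by (simp add: scale_op.rep_eq)
  then have VM: "V \<in> M"
    using comm by (simp add: mem_iff bounded_ops_def)
  have Vb: "V \<in> bounded_ops" by (rule bounded[OF VM])
  have "inner (V x) (V y) = inner (P x) (P y)" for x y
    unfolding dot_norm using norm_v[of x] norm_v[of y] norm_v[of "x + y"]
    by (simp add: V blinfun.add_right flip: V)
  then have VV: "adj V o\<^sub>L V = P"
    by (intro blinfun_inner_eqI) (simp add: inner_adj'[OF Vb] projD(5,6)[OF P])
  have VP: "V (P x) = V x" for x
    using uniq[OF v[of "P x"]] v[of x] by (simp add: V projD(5)[OF P])
  have VL: "V x \<in> L" for x
    using HL[OF v] by (simp add: V)
  have R_eq: "R y = V (adj V y)" for y
    unfolding R_def L_def[symmetric]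
  proof (rule orth_proj_eqI[OF L VL])
    have "snd ` G \<subseteq> {z. inner (y - V (adj V y)) z = 0}"
    proof clarify
      fix x z assume xz: "(x, z) \<in> G"
      then have "(x, z) \<in> H" unfolding H_def using closure_subset by blast
      moreover have "x \<in> D"
        unfolding D_def using xz closure_subset[of "fst ` G"] by force
      then have "P x = x" by (simp add: P_def D_def[symmetric] orth_proj_fixes[OF D])
      ultimately have "V x = z" using uniq v[of x] by (simp add: V)
      moreover have "adj V (V x) = x"
        using arg_cong[OF VV, of "\<lambda>T. blinfun_apply T x"] \<open>P x = x\<close> by simp
      ultimately show "inner (y - V (adj V y)) (snd (x, z)) = 0"
        by (simp add: inner_simps inner_adj[OF Vb])
          (metis inner_adj'[OF Vb])
    qed
    then have "closure (snd ` G) \<subseteq> {z. inner (y - V (adj V y)) z = 0}"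
      by (rule closure_minimal) (intro closed_Collect_eq continuous_intros)
    then show "inner (y - V (adj V y)) z = 0" if "z \<in> L" for z
      using that by (auto simp: L_def)
  qed
  have "R (V x) = V x" for x
    by (simp add: R_def L_def[symmetric] orth_proj_fixes[OF L VL])
  then have "R o\<^sub>L V = V" by (intro blinfun_eqI) simp
  moreover have "V o\<^sub>L adj V = R" "V o\<^sub>L P = V"
    by (auto intro!: blinfun_eqI simp: R_eq VP)
  moreover have "norm V \<le> 1"
    using proj_norm_apply_le[OF P] by (intro norm_blinfun_bound) (auto simp: V norm_v)
  ultimately show ?thesis
    using VM VV P R by blast
qed

end

section \<open>Comparison of projections in a factor\<close>

lemma (in von_neumann) proj_diff:
  assumes "E \<in> projections M" "P \<in> projections M" "E o\<^sub>L P = P"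
  shows "E - P \<in> projections M" "P o\<^sub>L E = P"
proof -
  have EP: "E (P x) = P x" for x
    using arg_cong[OF assms(3), of "\<lambda>T. blinfun_apply T x"] by simp
  have "inner (P (E x)) y = inner (P x) y" for x y
    by (metis EP assms(1,2) projD(6))
  then show PE: "P o\<^sub>L E = P"
    by (intro blinfun_inner_eqI) simp
  have "P (E x) = P x" for x
    using arg_cong[OF PE, of "\<lambda>T. blinfun_apply T x"] by simp
  then show "E - P \<in> projections M"
    using assms(1,2) by (intro projI) (auto simp: projD blinfun.bilinear_simps inner_simps EP)
qed

locale von_neumann_factor = von_neumann M for M :: "('h::chilbert_space \<Rightarrow>\<^sub>L 'h) set" +
  assumes factor: "factor M"
begin

text \<open>
  In a factor two nonzero projections are never disjoint. The subspace \<open>{z. F A z = 0 for all A}\<close> is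
  invariant under the algebra and under its commutant, so the projection onto it is central, hence a
  scalar. The subspace contains the range of \<open>E\<close>; if \<open>E \<noteq> 0\<close> it is therefore everything, and \<open>F = 0\<close>.
\<close>

lemma central_support:
  assumes E: "E \<in> projections M" and F: "F \<in> M"
    and disjoint: "\<And>A. A \<in> M \<Longrightarrow> F o\<^sub>L (A o\<^sub>L E) = 0"
  shows "E = 0 \<or> F = 0"
proof (rule disjCI)
  assume "F \<noteq> 0"
  define K where "K = (\<Inter>A\<in>M. {z. F (blinfun_apply A z) = 0})"
  have K_iff: "z \<in> K \<longleftrightarrow> (\<forall>A\<in>M. F (blinfun_apply A z) = 0)" for z
    by (simp add: K_def)
  have K: "subspace K" "closed K"
  proof -
    show "subspace K"
      by (auto simp: subspace_def K_iff blinfun.bilinear_simps)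
    show "closed K"
      unfolding K_def by (intro closed_INT ballI closed_Collect_eq continuous_intros)
  qed
  have "F (A (S z)) = S (F (A z))" if "S \<in> commutant M" "A \<in> M" for S A z
    by (simp add: commute[OF that(2,1)] commute[OF F that(1)])
  then have "orth_proj K \<in> M"
    using orth_proj_in[OF K] by (auto simp: K_iff projections_def)
  have inv: "A z \<in> K" if "A \<in> M" "z \<in> K" for A z
    unfolding K_iff
  proof
    fix B assume "B \<in> M"
    then have "B o\<^sub>L A \<in> M" using that by simp
    then show "F (B (A z)) = 0" using that(2) K_iff by fastforce
  qed
  have "orth_proj K o\<^sub>L A = A o\<^sub>L orth_proj K" if "A \<in> M" for A
    using that by (intro blinfun_eqI) (simp add: orth_proj_commutes[OF K bounded] inv)
  then have "orth_proj K \<in> commutant M"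
    using \<open>orth_proj K \<in> M\<close> by (simp add: commutant_def bounded)
  then obtain c where c: "orth_proj K = scale_op c id_blinfun"
    using factor \<open>orth_proj K \<in> M\<close> unfolding factor_def by blast
  have EK: "E x \<in> K" for x
    unfolding K_iff
  proof
    fix A assume "A \<in> M"
    then show "F (A (E x)) = 0"
      using arg_cong[OF disjoint, of A "\<lambda>T. blinfun_apply T x"] by simp
  qed
  show "E = 0"
  proof (rule ccontr)
    assume "E \<noteq> 0"
    then obtain x where x: "E x \<noteq> 0"
      by (metis blinfun_eqI zero_blinfun.rep_eq)
    have "c *\<^sub>C E x = 1 *\<^sub>C E x"
      using orth_proj_fixes[OF K EK[of x]] scaleC_of_real[of 1 "E x"] by (simp add: c scale_op.rep_eq)
    then have "(c - 1) *\<^sub>C E x = 0"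
      using scaleC_add_left[of "c - 1" 1 "E x"] by simp
    then have "c = 1"
      using norm_scaleC[of "c - 1" "E x"] x by simp
    then have "orth_proj K z = z" for z
      using scaleC_of_real[of 1 z] by (simp add: c scale_op.rep_eq)
    then have "z \<in> K" for z
      using orth_proj_fixes_iff[OF K] by blast
    then have "F z = 0" for z
      using id_mem K_iff by fastforce
    then show False
      using \<open>F \<noteq> 0\<close> by (metis blinfun_eqI zero_blinfun.rep_eq)
  qed
qed

text \<open>
  Take a maximal isometric graph \<open>G\<close> from the range of \<open>E\<close> to the range of \<open>F\<close>, and let \<open>E'\<close> and \<open>F'\<close> be
  what its domain and its range leave over of \<open>E\<close> and \<open>F\<close>. For \<open>T = F' A E'\<close> the polar decomposition
  provides the isometric graph of all \<open>(|T| z, T z)\<close>, which is orthogonal to \<open>G\<close> in both components. Adding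
  it to \<open>G\<close> contradicts maximality unless \<open>T = 0\<close>. So \<open>F' A E' = 0\<close> for all \<open>A\<close>, and in a factor this
  forces \<open>E' = 0\<close> or \<open>F' = 0\<close>.
\<close>

theorem comparison:
  assumes E: "E \<in> projections M" and F: "F \<in> projections M"
  shows "\<exists>V\<in>M. norm V \<le> 1
    \<and> (adj V o\<^sub>L V = E \<and> F o\<^sub>L V = V \<or> V o\<^sub>L adj V = F \<and> V o\<^sub>L E = V)"
proof -
  define \<G> where "\<G> = {G. isometric_graph G \<and> (\<forall>(x, y)\<in>G. E x = x \<and> F y = y)}"
  have "\<exists>G\<in>\<G>. \<forall>H\<in>\<G>. G \<subseteq> H \<longrightarrow> H = G"
  proof (rule subset_Zorn_nonempty)
    have "{0} \<in> \<G>"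
      by (auto simp: \<G>_def isometric_graph_def subspace_def zero_prod_def)
    then show "\<G> \<noteq> {}" by blast
    fix \<C> assume ne: "\<C> \<noteq> {}" and chain: "subset.chain \<G> \<C>"
    then have C: "\<C> \<subseteq> \<G>" and total: "\<And>X Y. X \<in> \<C> \<Longrightarrow> Y \<in> \<C> \<Longrightarrow> X \<subseteq> Y \<or> Y \<subseteq> X"
      by (auto simp: subset_chain_def)
    have sub: "subspace G" if "G \<in> \<C>" for G
      using C that by (auto simp: \<G>_def isometric_graph_def)
    have "subspace (\<Union>\<C>)"
      unfolding subspace_def
    proof (intro conjI ballI allI)
      show "0 \<in> \<Union>\<C>" using ne sub subspace_0 by blast
      show "c *\<^sub>R x \<in> \<Union>\<C>" if "x \<in> \<Union>\<C>" for c x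
        using that sub subspace_scale by blast
      fix x y assume "x \<in> \<Union>\<C>" "y \<in> \<Union>\<C>"
      then obtain X Y where XY: "X \<in> \<C>" "Y \<in> \<C>" "x \<in> X" "y \<in> Y" by blast
      from total[OF XY(1,2)] show "x + y \<in> \<Union>\<C>"
      proof
        assume "X \<subseteq> Y"
        then have "x + y \<in> Y" using XY sub by (auto intro: subspace_add)
        then show ?thesis using XY by blast
      next
        assume "Y \<subseteq> X"
        then have "x + y \<in> X" using XY sub by (auto intro: subspace_add)
        then show ?thesis using XY by blast
      qed
    qed
    then show "\<Union>\<C> \<in> \<G>"
      using C unfolding \<G>_def isometric_graph_def by fast
  qed
  then obtain G where "G \<in> \<G>" and max: "\<And>H. H \<in> \<G> \<Longrightarrow> G \<subseteq> H \<Longrightarrow> H = G"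
    by blast
  then have G: "isometric_graph G" and EF: "\<And>x y. (x, y) \<in> G \<Longrightarrow> E x = x \<and> F y = y"
    unfolding \<G>_def by auto
  define P where "P = orth_proj (closure (fst ` G))"
  define R where "R = orth_proj (closure (snd ` G))"
  obtain V where V: "V \<in> M" "adj V o\<^sub>L V = P" "V o\<^sub>L adj V = R" "V o\<^sub>L P = V" "R o\<^sub>L V = V"
      "norm V \<le> 1" and P: "P \<in> projections M" and R: "R \<in> projections M"
    using partial_isometry_of_graph[OF G] unfolding P_def R_def by blast
  have lin: "linear (fst :: 'h \<times> 'h \<Rightarrow> 'h)" "linear (snd :: 'h \<times> 'h \<Rightarrow> 'h)"
    by (auto intro!: linearI)
  have D: "subspace (closure (fst ` G))" "closed (closure (fst ` G))"
    and L: "subspace (closure (snd ` G))" "closed (closure (snd ` G))"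
    by (auto intro!: subspace_closure linear_subspace_image lin isometric_graphD(1)[OF G])
  have fixed_closed: "closed {x. A x = x}" for A :: "'h \<Rightarrow>\<^sub>L 'h"
    by (intro closed_Collect_eq continuous_intros)
  have "closure (fst ` G) \<subseteq> {x. E x = x}"
    by (rule closure_minimal[OF _ fixed_closed]) (use EF in auto)
  then have EP: "E o\<^sub>L P = P"
    using orth_proj(1)[OF D] by (intro blinfun_eqI) (auto simp: P_def)
  have "closure (snd ` G) \<subseteq> {x. F x = x}"
    by (rule closure_minimal[OF _ fixed_closed]) (use EF in auto)
  then have FR: "F o\<^sub>L R = R"
    using orth_proj(1)[OF L] by (intro blinfun_eqI) (auto simp: R_def)
  define E' where "E' = E - P"
  define F' where "F' = F - R"
  have E': "E' \<in> projections M" and F': "F' \<in> projections M"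
    unfolding E'_def F'_def using proj_diff(1) E F P R EP FR by auto
  have E'_fst: "E' x = 0" and F'_snd: "F' y = 0" if "(x, y) \<in> G" for x y
  proof -
    have "x \<in> closure (fst ` G)" "y \<in> closure (snd ` G)"
      using that closure_subset[of "fst ` G"] closure_subset[of "snd ` G"] by force+
    then show "E' x = 0" "F' y = 0"
      using EF[OF that] orth_proj_fixes[OF D] orth_proj_fixes[OF L]
      by (auto simp: E'_def F'_def P_def R_def blinfun.diff_left)
  qed
  have EE': "E (E' x) = E' x" and FF': "F (F' x) = F' x" for x
    using arg_cong[OF EP, of "\<lambda>T. blinfun_apply T x"] arg_cong[OF FR, of "\<lambda>T. blinfun_apply T x"]
    by (auto simp: E'_def F'_def blinfun.bilinear_simps projD(5)[OF E] projD(5)[OF F])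
  have "F' o\<^sub>L (A o\<^sub>L E') = 0" if A: "A \<in> M" for A
  proof -
    define T where "T = F' o\<^sub>L (A o\<^sub>L E')"
    have T: "T \<in> M" using A projD(1)[OF E'] projD(1)[OF F'] by (simp add: T_def)
    obtain S where S: "S \<in> M" "adj S = S" "S o\<^sub>L S = adj T o\<^sub>L T"
      using absolute_value[OF T] by blast
    have S_inner: "inner (S x) y = inner x (S y)" for x y
      using inner_adj[OF bounded[OF S(1)], of x y] by (simp add: S(2))
    have S_norm: "norm (S z) = norm (T z)" for z
    proof -
      have "inner ((S o\<^sub>L S) z) z = inner ((adj T o\<^sub>L T) z) z" by (simp add: S(3))
      then show ?thesis
        by (simp add: S_inner inner_adj'[OF bounded[OF T]] norm_eq_sqrt_inner)
    qed
    have "S (E' z) = S z" for z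
    proof -
      have "norm (S (z - E' z)) = 0"
        unfolding S_norm by (simp add: T_def blinfun.diff_right projD(5)[OF E'])
      then show ?thesis by (simp add: blinfun.diff_right)
    qed
    then have "inner (E' (S x)) y = inner (S x) y" for x y
      by (metis S_inner projD(6)[OF E'])
    then have E'S: "E' (S z) = S z" for z
      using vector_eq_rdot by blast
    have F'T: "F' (T z) = T z" for z
      by (simp add: T_def projD(5)[OF F'])
    define H where "H = (\<lambda>(p, z). (fst p + S z, snd p + T z)) ` (G \<times> UNIV)"
    have H_iff: "q \<in> H \<longleftrightarrow> (\<exists>x y z. (x, y) \<in> G \<and> q = (x + S z, y + T z))" for q
      unfolding H_def by force
    have "subspace H"
      unfolding H_def
    proof (rule linear_subspace_image)
      show "linear (\<lambda>(p, z). (fst p + S z, snd p + T z))"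
        by (rule linearI) (auto simp: blinfun.bilinear_simps scaleR_add_right algebra_simps)
      show "subspace (G \<times> (UNIV :: 'h set))"
        using isometric_graphD(1)[OF G] by (intro subspace_Times) auto
    qed
    moreover have "norm (x + S z) = norm (y + T z)" if xy: "(x, y) \<in> G" for x y z
    proof -
      have "inner x (S z) = 0" "inner y (T z) = 0"
        using projD(6)[OF E', of x "S z"] projD(6)[OF F', of y "T z"] E'_fst[OF xy] F'_snd[OF xy]
        by (simp_all add: E'S F'T)
      moreover have "norm x = norm y" by (rule isometric_graphD(2)[OF G xy])
      ultimately have "(norm (x + S z))\<^sup>2 = (norm (y + T z))\<^sup>2"
        using S_norm[of z] by (simp add: power2_norm_eq_inner inner_simps inner_commute norm_eq)
      then show ?thesis by simp
    qed
    moreover have "(B u, B w) \<in> H" if B: "B \<in> commutant M" and uw: "(u, w) \<in> H" for B u w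
    proof -
      obtain x y z where "(x, y) \<in> G" "u = x + S z" "w = y + T z"
        using uw H_iff by auto
      moreover from this have "(B x, B y) \<in> G" using isometric_graphD(3)[OF G B] by blast
      ultimately show ?thesis
        unfolding H_iff by (intro exI[of _ "B x"] exI[of _ "B y"] exI[of _ "B z"])
          (simp add: blinfun.add_right commute[OF S(1) B] commute[OF T B])
    qed
    ultimately have "isometric_graph H"
      unfolding isometric_graph_def by (auto simp: H_iff)
    moreover have "E (x + S z) = x + S z" "F (y + T z) = y + T z" if "(x, y) \<in> G" for x y z
      using EF[OF that] EE'[of "S z"] FF'[of "T z"] by (simp_all add: E'S F'T blinfun.add_right)
    ultimately have "H \<in> \<G>"
      unfolding \<G>_def by (auto simp: H_iff)
    moreover have "G \<subseteq> H"
    proof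
      fix p assume "p \<in> G"
      then show "p \<in> H"
        unfolding H_iff by (intro exI[of _ "fst p"] exI[of _ "snd p"] exI[of _ 0]) simp
    qed
    ultimately have "H = G" by (rule max)
    moreover have "(S z, T z) \<in> H" for z
      unfolding H_iff using subspace_0[OF isometric_graphD(1)[OF G]]
      by (intro exI[of _ 0] exI[of _ z]) (simp add: zero_prod_def)
    ultimately have "T z = 0" for z
      using F'_snd F'T by metis
    then show ?thesis
      unfolding T_def[symmetric] by (intro blinfun_eqI) simp
  qed
  then consider "E' = 0" | "F' = 0"
    using central_support[OF E' projD(1)[OF F']] by blast
  then show ?thesis
  proof cases
    case 1
    have "F (V x) = V x" for x
      using arg_cong[OF V(5), of "\<lambda>T. blinfun_apply T x"]
        arg_cong[OF FR, of "\<lambda>T. blinfun_apply T (V x)"] by simp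
    then have "F o\<^sub>L V = V" by (intro blinfun_eqI) simp
    then show ?thesis using 1 V by (auto simp: E'_def)
  next
    case 2
    have "V (E x) = V x" for x
      using arg_cong[OF V(4), of "\<lambda>T. blinfun_apply T x"]
        arg_cong[OF V(4), of "\<lambda>T. blinfun_apply T (E x)"]
        arg_cong[OF proj_diff(2)[OF E P EP], of "\<lambda>T. blinfun_apply T x"] by simp
    then have "V o\<^sub>L E = V" by (intro blinfun_eqI) simp
    then show ?thesis using 2 V by (auto simp: F'_def)
  qed
qed

end

section \<open>Trace and finiteness\<close>

context von_neumann
begin

lemma comp_adj_proj:
  assumes V: "V \<in> M" and Q: "Q \<in> projections M" and VV: "adj V o\<^sub>L V = Q"
  shows "V o\<^sub>L Q = V" "V o\<^sub>L adj V \<in> projections M"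
proof -
  have Vb: "V \<in> bounded_ops" by (rule bounded[OF V])
  have norm_V: "norm (V x) = norm (Q x)" for x
  proof -
    have "inner (V x) (V x) = inner (Q x) x"
      using inner_adj_comp[OF Vb, of x x] by (simp add: VV)
    then show ?thesis
      by (simp add: proj_norm_sq[OF Q] norm_eq_sqrt_inner power2_norm_eq_inner)
  qed
  have VQ: "V (Q x) = V x" for x
  proof -
    have "norm (V (x - Q x)) = 0"
      unfolding norm_V by (simp add: blinfun.diff_right projD(5)[OF Q])
    then show ?thesis by (simp add: blinfun.diff_right)
  qed
  then show "V o\<^sub>L Q = V" by (intro blinfun_eqI) simp
  have "adj V (V x) = Q x" for x
    using arg_cong[OF VV, of "\<lambda>T. blinfun_apply T x"] by simp
  then show "V o\<^sub>L adj V \<in> projections M"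
    using V by (intro projI) (auto simp: inner_adj[OF Vb] inner_adj'[OF Vb] VQ)
qed

end

locale finite_factor = von_neumann_factor M for M :: "('h::chilbert_space \<Rightarrow>\<^sub>L 'h) set" +
  assumes isometry_unitary: "V \<in> M \<Longrightarrow> adj V o\<^sub>L V = id_blinfun \<Longrightarrow> V o\<^sub>L adj V = id_blinfun"
begin

text \<open>
  Infinitely many orthogonal copies \<open>V\<^sub>i V\<^sub>i\<^sup>*\<close> of \<open>Q\<close> allow a shift: the isometry that maps \<open>V\<^sub>i y\<close> to
  \<open>V\<^sub>i\<^sub>+\<^sub>1 y\<close> and fixes the vectors orthogonal to all copies. Its range is orthogonal to the copy
  number \<open>0\<close>, whereas in a finite algebra an isometry is unitary.
\<close>

lemma no_infinite_copies:
  fixes V :: "nat \<Rightarrow> ('h \<Rightarrow>\<^sub>L 'h)"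
  assumes V: "\<And>i. V i \<in> M" and VV: "\<And>i. adj (V i) o\<^sub>L V i = Q"
    and orth: "\<And>i j. i \<noteq> j \<Longrightarrow> adj (V i) o\<^sub>L V j = 0"
  shows "Q = 0"
proof -
  have Vb: "V i \<in> bounded_ops" for i by (rule bounded[OF V])
  have VV': "adj (V i) (V j x) = (if i = j then Q x else 0)" for i j x
    using arg_cong[OF VV[of i], of "\<lambda>T. blinfun_apply T x"]
      arg_cong[OF orth[of i j], of "\<lambda>T. blinfun_apply T x"] by auto
  \<comment> \<open>\<open>Z\<close> is the orthogonal complement of all copies, \<open>s k n f\<close> a finite sum of vectors from the copies
    \<open>k\<close>, ..., \<open>k + n - 1\<close>, and \<open>G\<close> the graph of the shift on its dense domain of finite sums.\<close>
  define Z where "Z = {z. \<forall>i. adj (V i) z = 0}"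
  define s where "s k n f = (\<Sum>i<n. V (k + i) (f i))" for k n :: nat and f
  define G where "G = {(s 0 n f + z, s 1 n f + z) | n f z. z \<in> Z}"
  have s_pad: "s k m (\<lambda>i. if i < n then f i else 0) = s k n f" if "n \<le> m" for k m n f
    unfolding s_def by (rule sum.mono_neutral_cong_right) (use that in auto)
  have s_add: "s k n (\<lambda>i. f i + g i) = s k n f + s k n g" for k n f g
    by (simp add: s_def blinfun.add_right sum.distrib)
  have norm_s: "(norm (s k n f + z))\<^sup>2 = (\<Sum>i<n. inner (Q (f i)) (f i)) + (norm z)\<^sup>2"
    if z: "z \<in> Z" for k n f z
  proof (induction n)
    case (Suc n)
    have "adj (V (k + n)) (s k n f + z) = 0"
      using z by (simp add: s_def blinfun.add_right blinfun.sum_right VV' Z_def)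
    then have "inner (s k n f + z) (V (k + n) (f n)) = 0"
      using inner_adj'[OF Vb, of "k + n" "s k n f + z" "f n"] by simp
    moreover have "inner (V (k + n) (f n)) (V (k + n) (f n)) = inner (Q (f n)) (f n)"
      using inner_adj'[OF Vb, of "k + n" "V (k + n) (f n)" "f n"] by (simp add: VV')
    moreover have "s k (Suc n) f + z = (s k n f + z) + V (k + n) (f n)"
      by (simp add: s_def)
    ultimately show ?case
      using Suc by (simp add: power2_norm_eq_inner inner_simps inner_commute)
  qed (simp add: s_def)
  have GI: "(s 0 n f + z, s 1 n f + z) \<in> G" if "z \<in> Z" for n f z
    unfolding G_def using that by blast
  have Z_sub: "subspace Z"
    by (auto simp: Z_def subspace_def blinfun.bilinear_simps)
  have "subspace G"
    unfolding subspace_def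
  proof (intro conjI ballI allI)
    show "0 \<in> G"
      using GI[of 0 0 "\<lambda>_. 0"] subspace_0[OF Z_sub] by (simp add: s_def zero_prod_def)
    fix p assume "p \<in> G"
    then obtain n f z where p: "p = (s 0 n f + z, s 1 n f + z)" "z \<in> Z"
      unfolding G_def by blast
    show "c *\<^sub>R p \<in> G" for c
      using GI[of "c *\<^sub>R z" n "\<lambda>i. c *\<^sub>R f i"] p subspace_scale[OF Z_sub]
      by (simp add: s_def blinfun.scaleR_right scaleR_sum_right scaleR_add_right)
    fix q assume "q \<in> G"
    then obtain m g w where q: "q = (s 0 m g + w, s 1 m g + w)" "w \<in> Z"
      unfolding G_def by blast
    have "s k (max n m) (\<lambda>i. (if i < n then f i else 0) + (if i < m then g i else 0))
        = s k n f + s k m g" for k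
      by (simp add: s_add s_pad)
    then show "p + q \<in> G"
      using GI[of "z + w" "max n m" "\<lambda>i. (if i < n then f i else 0) + (if i < m then g i else 0)"]
        p q subspace_add[OF Z_sub] by (simp add: algebra_simps)
  qed
  moreover have "norm x = norm y" if xy: "(x, y) \<in> G" for x y
  proof -
    obtain n f z where "x = s 0 n f + z" "y = s 1 n f + z" "z \<in> Z"
      using xy unfolding G_def by auto
    then have "(norm x)\<^sup>2 = (norm y)\<^sup>2" by (simp add: norm_s)
    then show ?thesis by simp
  qed
  moreover have "(S x, S y) \<in> G" if S: "S \<in> commutant M" and xy: "(x, y) \<in> G" for S x y
  proof -
    obtain n f z where *: "x = s 0 n f + z" "y = s 1 n f + z" "z \<in> Z"
      using xy unfolding G_def by auto
    have "S z \<in> Z"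
      using *(3) commute[OF adj_mem[OF V] S] by (simp add: Z_def)
    moreover have "S (s k n f) = s k n (\<lambda>i. S (f i))" for k
      by (simp add: s_def blinfun.sum_right commute[OF V S])
    ultimately show ?thesis
      using GI[of "S z" n "\<lambda>i. S (f i)"] * by (simp add: blinfun.add_right)
  qed
  ultimately have G: "isometric_graph G"
    unfolding isometric_graph_def by blast
  have shift: "(V i y, V (Suc i) y) \<in> G" for i y
  proof -
    have "s k (Suc i) (\<lambda>j. if j = i then y else 0) = V (k + i) y" for k
      unfolding s_def by (subst sum.remove[of _ i]) auto
    then show ?thesis
      using GI[OF subspace_0[OF Z_sub], of "Suc i" "\<lambda>j. if j = i then y else 0"] by simp
  qed
  have lin: "linear (fst :: 'h \<times> 'h \<Rightarrow> 'h)" "linear (snd :: 'h \<times> 'h \<Rightarrow> 'h)"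
    by (auto intro!: linearI)
  have D: "subspace (closure (fst ` G))" "closed (closure (fst ` G))"
    and L: "subspace (closure (snd ` G))" "closed (closure (snd ` G))"
    by (auto intro!: subspace_closure linear_subspace_image lin isometric_graphD(1)[OF G])
  obtain W where W: "W \<in> M" "adj W o\<^sub>L W = orth_proj (closure (fst ` G))"
      "W o\<^sub>L adj W = orth_proj (closure (snd ` G))"
    using partial_isometry_of_graph[OF G] by blast
  have "orth_proj (closure (fst ` G)) x = x" for x
  proof -
    define w where "w = x - orth_proj (closure (fst ` G)) x"
    have w: "inner w z = 0" if "z \<in> fst ` G" for z
      unfolding w_def by (rule orth_proj(2)[OF D subsetD[OF closure_subset that]])
    have "inner (adj (V i) w) y = 0" for i y
      using w[OF image_eqI[OF _ shift[of i y]]] by (simp add: inner_adj'[OF Vb])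
    then have "w \<in> Z"
      using inner_eq_zero_iff unfolding Z_def by blast
    moreover have "(s 0 0 (\<lambda>_. 0) + w, s 1 0 (\<lambda>_. 0) + w) = (w, w)"
      by (simp add: s_def)
    ultimately have "(w, w) \<in> G"
      using GI by metis
    then have "w \<in> fst ` G"
      by (rule image_eqI[rotated]) simp
    then have "inner w w = 0" by (rule w)
    then show ?thesis by (simp add: w_def)
  qed
  then have "adj W o\<^sub>L W = id_blinfun"
    by (intro blinfun_eqI) (simp add: W(2))
  then have "W o\<^sub>L adj W = id_blinfun"
    by (rule isometry_unitary[OF W(1)])
  then have "orth_proj (closure (snd ` G)) y = y" for y
    by (simp add: W(3))
  then have "closure (snd ` G) = UNIV"
    using orth_proj_fixes_iff[OF L] by blast
  moreover have "closure (snd ` G) \<subseteq> {y. adj (V 0) y = 0}"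
  proof (rule closure_minimal)
    show "snd ` G \<subseteq> {y. adj (V 0) y = 0}"
      by (auto simp: G_def s_def Z_def blinfun.add_right blinfun.sum_right VV')
  qed (intro closed_Collect_eq continuous_intros)
  ultimately have "adj (V 0) y = 0" for y by blast
  then show "Q = 0"
    by (subst VV[of 0, symmetric], intro blinfun_eqI) simp
qed

end

locale II1_factor = finite_factor M for M :: "('h::chilbert_space \<Rightarrow>\<^sub>L 'h) set" +
  fixes \<tau> :: "('h \<Rightarrow>\<^sub>L 'h) \<Rightarrow> complex"
  assumes trace: "tracial_state M \<tau>"
    and no_minimal: "E \<in> projections M \<Longrightarrow> E \<noteq> 0 \<Longrightarrow>
          \<exists>F\<in>projections M. F \<noteq> 0 \<and> F \<noteq> E \<and> E o\<^sub>L F = F"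
begin

definition tr :: "('h \<Rightarrow>\<^sub>L 'h) \<Rightarrow> real" where
  "tr T = Re (\<tau> T)"

lemma tr_add: "S \<in> M \<Longrightarrow> T \<in> M \<Longrightarrow> tr (S + T) = tr S + tr T"
  and tr_id: "tr id_blinfun = 1"
  and tr_commute: "S \<in> M \<Longrightarrow> T \<in> M \<Longrightarrow> tr (S o\<^sub>L T) = tr (T o\<^sub>L S)"
  using trace by (simp_all add: tracial_state_def tr_def)

lemma tr_scaleR: "T \<in> M \<Longrightarrow> tr (r *\<^sub>R T) = r * tr T"
  using trace by (simp add: tracial_state_def tr_def scaleR_op)

lemma tr_diff: "S \<in> M \<Longrightarrow> T \<in> M \<Longrightarrow> tr (S - T) = tr S - tr T"
  using tr_add[of S "(- 1) *\<^sub>R T"] tr_scaleR[of T "- 1"] by simp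

lemma tr_sum: "(\<And>i. i \<in> I \<Longrightarrow> f i \<in> M) \<Longrightarrow> tr (sum f I) = (\<Sum>i\<in>I. tr (f i))"
proof (induction I rule: infinite_finite_induct)
  case (insert i I)
  then show ?case by (simp add: tr_add)
qed (use tr_diff[of 0 0] in auto)

lemma tr_nonneg: "T \<in> M \<Longrightarrow> 0 \<le> tr (adj T o\<^sub>L T)"
  using trace by (auto simp: tracial_state_def tr_def complex_nonneg_Reals_iff)

lemma tr_proj_nonneg: "E \<in> projections M \<Longrightarrow> 0 \<le> tr E"
  using tr_nonneg[of E] by (simp add: projD)

lemma tr_proj_le_1: "E \<in> projections M \<Longrightarrow> tr E \<le> 1"
proof -
  assume E: "E \<in> projections M"
  have "id_blinfun o\<^sub>L E = E" by (rule blinfun_eqI) simp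
  then have "id_blinfun - E \<in> projections M"
    by (rule proj_diff(1)[OF id_proj E])
  from tr_proj_nonneg[OF this] show ?thesis
    using projD(1)[OF E] by (simp add: tr_diff tr_id)
qed

text \<open>
  Scaled to \<open>\<parallel>Z\<parallel> \<le> 1\<close>, the difference \<open>A\<^sup>* A - A\<^sup>* Z\<^sup>* Z A\<close> equals \<open>(S A)\<^sup>* (S A)\<close> for the square root
  \<open>S\<close> of \<open>1 - Z\<^sup>* Z\<close>, so its trace is nonnegative.
\<close>

lemma tr_comp_le:
  assumes A: "A \<in> M" and Z: "Z \<in> M" "norm Z \<le> k" "0 < k"
  shows "tr (adj (Z o\<^sub>L A) o\<^sub>L (Z o\<^sub>L A)) \<le> k\<^sup>2 * tr (adj A o\<^sub>L A)"
proof -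
  define R where "R = inverse k *\<^sub>R Z"
  define X where "X = adj R o\<^sub>L R"
  have R: "R \<in> M" "norm R \<le> 1"
    using Z by (simp_all add: R_def field_simps)
  have X: "X \<in> M" "adj X = X"
    using R by (auto simp: X_def adj_compose adj_adj bounded adj_bounded_ops)
  have "norm X \<le> norm (adj R) * norm R"
    unfolding X_def by (rule norm_blinfun_compose)
  also have "\<dots> \<le> 1"
    using R(2) order_trans[OF norm_adj_le[OF bounded[OF R(1)]] R(2)] by (simp add: mult_le_one)
  finally obtain S where S: "S \<in> M" "adj S = S" "S o\<^sub>L S = id_blinfun - X"
    using sqrt_one_minus[OF X] by blast
  have SS: "S (S x) = x - X x" for x
    using arg_cong[OF S(3), of "\<lambda>T. blinfun_apply T x"] by (simp add: blinfun.diff_left)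
  have "adj (S o\<^sub>L A) o\<^sub>L (S o\<^sub>L A) = (adj A o\<^sub>L A) - (1 / k\<^sup>2) *\<^sub>R (adj (Z o\<^sub>L A) o\<^sub>L (Z o\<^sub>L A))"
  proof (rule blinfun_inner_eqI)
    fix x y
    have bs: "S o\<^sub>L A \<in> bounded_ops" "Z o\<^sub>L A \<in> bounded_ops" "A \<in> bounded_ops" "R \<in> bounded_ops"
      using A Z S R by (auto intro: bounded)
    have "inner (S (A x)) (S (A y)) = inner (A x) (A y) - inner (R (A x)) (R (A y))"
      using inner_adj[OF bounded[OF S(1)], of "S (A x)" "A y"]
        inner_adj[OF bounded[OF S(1)], of "A x" "S (A y)"]
      by (simp add: S(2) SS X_def inner_simps inner_adj[OF bs(4)])
    moreover have "inner (R (A x)) (R (A y)) = inner (Z (A x)) (Z (A y)) / k\<^sup>2"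
      by (simp add: R_def blinfun.scaleR_left power2_eq_square divide_inverse)
    ultimately show "inner ((adj (S o\<^sub>L A) o\<^sub>L (S o\<^sub>L A)) x) y
        = inner (((adj A o\<^sub>L A) - (1 / k\<^sup>2) *\<^sub>R (adj (Z o\<^sub>L A) o\<^sub>L (Z o\<^sub>L A))) x) y"
      unfolding blinfun.diff_left blinfun.scaleR_left inner_diff_left inner_scaleR_left
        inner_adj_comp[OF bs(1)] inner_adj_comp[OF bs(2)] inner_adj_comp[OF bs(3)]
      by simp
  qed
  then have "0 \<le> tr (adj A o\<^sub>L A) - (1 / k\<^sup>2) * tr (adj (Z o\<^sub>L A) o\<^sub>L (Z o\<^sub>L A))"
    using tr_nonneg[of "S o\<^sub>L A"] A S Z by (simp add: tr_diff tr_scaleR)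
  then show ?thesis
    using Z(3) by (simp add: field_simps)
qed

lemma tr_compression_le:
  assumes V: "V \<in> M" "norm V \<le> 1" and Q: "Q \<in> projections M"
  shows "tr (V o\<^sub>L (Q o\<^sub>L adj V)) \<le> tr Q"
proof -
  have "V o\<^sub>L (Q o\<^sub>L adj V) = (V o\<^sub>L Q) o\<^sub>L adj (V o\<^sub>L Q)"
    using V by (simp add: adj_compose bounded projD[OF Q] blinfun_eq_iff)
  then have "tr (V o\<^sub>L (Q o\<^sub>L adj V)) = tr (adj (V o\<^sub>L Q) o\<^sub>L (V o\<^sub>L Q))"
    using V projD(1)[OF Q] by (simp add: tr_commute)
  also have "\<dots> \<le> 1\<^sup>2 * tr (adj Q o\<^sub>L Q)"
    by (rule tr_comp_le) (use V projD[OF Q] in auto)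
  finally show ?thesis by (simp add: projD[OF Q])
qed

text \<open>
  Starting from the identity, split off copies of \<open>Q\<close> from the remainder \<open>R n\<close> as long as possible. At
  the first \<open>k\<close> for which \<open>R k\<close> contains no copy of \<open>Q\<close>, comparison makes \<open>R k\<close> a copy of a subprojection
  of \<open>Q\<close>, that is \<open>R k = U Q U\<^sup>*\<close>. Since the \<open>k\<close> orthogonal copies have the trace of \<open>Q\<close>, \<open>k \<tau>(Q) \<le> 1\<close>.
\<close>

lemma finite_cover:
  assumes Q: "Q \<in> projections M" "Q \<noteq> 0"
  shows "\<exists>(k::nat) V. (\<forall>i. V i \<in> M \<and> norm (V i) \<le> 1) \<and> real k * tr Q \<le> 1
    \<and> (\<Sum>i\<le>k. V i o\<^sub>L (Q o\<^sub>L adj (V i))) = id_blinfun"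
proof -
  define copy where "copy R V \<longleftrightarrow> V \<in> M \<and> norm V \<le> 1 \<and> adj V o\<^sub>L V = Q \<and> R o\<^sub>L V = V" for R V
  define c where "c R = (SOME V. copy R V)" for R
  define R where "R n = ((\<lambda>R. R - (c R o\<^sub>L adj (c R))) ^^ n) id_blinfun" for n
  define V where "V n = c (R n)" for n
  have R0: "R 0 = id_blinfun" and R_Suc: "R (Suc n) = R n - (V n o\<^sub>L adj (V n))" for n
    by (simp_all add: R_def V_def)
  have copy: "copy (R n) (V n)" if "\<exists>V. copy (R n) V" for n
    unfolding V_def c_def using that by (rule someI_ex)
  have step: "R (Suc n) \<in> projections M" "R (Suc n) o\<^sub>L R n = R (Suc n)" "R (Suc n) o\<^sub>L V n = 0"
    if Rn: "R n \<in> projections M" and cn: "copy (R n) (V n)" for n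
  proof -
    have Vn: "V n \<in> M" "adj (V n) o\<^sub>L V n = Q" "R n o\<^sub>L V n = V n"
      using cn by (auto simp: copy_def)
    have RV: "R n (V n x) = V n x" for x
      using arg_cong[OF Vn(3), of "\<lambda>T. blinfun_apply T x"] by simp
    have sub: "R n o\<^sub>L (V n o\<^sub>L adj (V n)) = V n o\<^sub>L adj (V n)"
      by (intro blinfun_eqI) (simp add: RV)
    note d = proj_diff[OF Rn comp_adj_proj(2)[OF Vn(1) Q(1) Vn(2)] sub]
    show "R (Suc n) \<in> projections M"
      using d(1) by (simp add: R_Suc)
    show "R (Suc n) o\<^sub>L R n = R (Suc n)"
      using arg_cong[OF d(2), of "\<lambda>T. blinfun_apply T x" for x]
      by (intro blinfun_eqI) (simp add: R_Suc blinfun.diff_left projD(5)[OF Rn])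
    have "V n (adj (V n) (V n x)) = V n x" for x
      using arg_cong[OF Vn(2), of "\<lambda>T. blinfun_apply T x"]
        arg_cong[OF comp_adj_proj(1)[OF Vn(1) Q(1) Vn(2)], of "\<lambda>T. blinfun_apply T x"] by simp
    then show "R (Suc n) o\<^sub>L V n = 0"
      by (intro blinfun_eqI) (simp add: R_Suc blinfun.diff_left RV)
  qed
  have "\<exists>n. \<nexists>V. copy (R n) V"
  proof (rule ccontr)
    assume "\<nexists>n. \<nexists>V. copy (R n) V"
    then have cn: "copy (R n) (V n)" for n using copy by blast
    have Rn: "R n \<in> projections M" for n
      by (induction n) (auto simp: R0 step cn)
    have later: "R (Suc i + d) o\<^sub>L V i = 0" for i d
    proof (induction d)
      case (Suc d)
      have "R (Suc i + Suc d) o\<^sub>L V i = R (Suc i + Suc d) o\<^sub>L (R (Suc i + d) o\<^sub>L V i)"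
        using step(2)[OF Rn cn, of "Suc i + d"] by (metis add_Suc_right blinfun_compose_assoc)
      then show ?case using Suc by simp
    qed (simp add: step(3)[OF Rn cn])
    have less: "inner (V j x) (V i y) = 0" if "i < j" for i j x y
    proof -
      have "R j o\<^sub>L V i = 0"
        using later[of i "j - Suc i"] that by simp
      then have "R j (V i y) = 0"
        by (metis blinfun_apply_blinfun_compose zero_blinfun.rep_eq)
      moreover have "R j (V j x) = V j x"
        using cn[of j] unfolding copy_def by (metis blinfun_apply_blinfun_compose)
      ultimately show ?thesis
        using projD(6)[OF Rn, of j "V j x" "V i y"] by simp
    qed
    have VM: "V i \<in> M" for i using cn by (simp add: copy_def)
    have "adj (V i) o\<^sub>L V j = 0" if "i \<noteq> j" for i j
    proof (rule blinfun_inner_eqI)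
      fix x y
      have "inner (V j x) (V i y) = 0"
        using less[of i j x y] less[of j i y x] that by (metis inner_commute linorder_neqE_nat)
      then show "inner ((adj (V i) o\<^sub>L V j) x) y = inner (blinfun_apply 0 x) y"
        by (simp add: inner_adj'[OF bounded[OF VM]])
    qed
    then have "Q = 0"
      using no_infinite_copies[of V Q] cn by (auto simp: copy_def)
    then show False using Q(2) by simp
  qed
  then obtain k where k: "\<nexists>V. copy (R k) V" "\<And>i. i < k \<Longrightarrow> \<exists>V. copy (R i) V"
    using exists_least_iff[of "\<lambda>n. \<nexists>V. copy (R n) V"] by blast
  have cV: "copy (R i) (V i)" if "i < k" for i
    by (rule copy[OF k(2)[OF that]])
  have VM: "V i \<in> M" "norm (V i) \<le> 1" "adj (V i) o\<^sub>L V i = Q" if "i < k" for i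
    using cV[OF that] by (auto simp: copy_def)
  have "n \<le> k \<Longrightarrow> R n \<in> projections M" for n
    by (induction n) (auto simp: R0 step cV)
  then have Rk: "R k \<in> projections M" by simp
  have total: "(\<Sum>i<n. V i o\<^sub>L adj (V i)) + R n = id_blinfun" for n
    by (induction n) (simp_all add: R0 R_Suc algebra_simps)
  have "1 = tr ((\<Sum>i<k. V i o\<^sub>L adj (V i)) + R k)"
    by (simp add: total tr_id)
  also have "\<dots> = (\<Sum>i<k. tr (V i o\<^sub>L adj (V i))) + tr (R k)"
  proof -
    have mem: "V i o\<^sub>L adj (V i) \<in> M" if "i \<in> {..<k}" for i
      using that VM(1)[of i] by simp
    show ?thesis
      using tr_add[OF sum_mem projD(1)[OF Rk], of "{..<k}" "\<lambda>i. V i o\<^sub>L adj (V i)"]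
        tr_sum[of "{..<k}" "\<lambda>i. V i o\<^sub>L adj (V i)"] mem by simp
  qed
  also have "(\<Sum>i<k. tr (V i o\<^sub>L adj (V i))) = (\<Sum>i<k. tr Q)"
  proof (rule sum.cong)
    fix i assume "i \<in> {..<k}"
    then show "tr (V i o\<^sub>L adj (V i)) = tr Q"
      using tr_commute[of "V i" "adj (V i)"] VM[of i] by simp
  qed simp
  finally have "real k * tr Q \<le> 1"
    using tr_proj_nonneg[OF Rk] by simp
  moreover obtain U where U: "U \<in> M" "norm U \<le> 1" "U o\<^sub>L adj U = R k" "U o\<^sub>L Q = U"
    using comparison[OF Q(1) Rk] k(1) unfolding copy_def by blast
  define W where "W i = (if i < k then V i else U)" for i
  have "(\<Sum>i\<le>k. W i o\<^sub>L (Q o\<^sub>L adj (W i))) = id_blinfun"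
  proof -
    have "W i o\<^sub>L (Q o\<^sub>L adj (W i)) = W i o\<^sub>L adj (W i)" for i
    proof -
      have "W i o\<^sub>L Q = W i"
        using U(4) comp_adj_proj(1)[OF VM(1) Q(1) VM(3)] by (simp add: W_def)
      then show ?thesis by (metis blinfun_compose_assoc)
    qed
    then have "(\<Sum>i\<le>k. W i o\<^sub>L (Q o\<^sub>L adj (W i))) = (\<Sum>i<k. W i o\<^sub>L adj (W i)) + (W k o\<^sub>L adj (W k))"
      by (simp flip: lessThan_Suc_atMost)
    also have "\<dots> = (\<Sum>i<k. V i o\<^sub>L adj (V i)) + R k"
      by (simp add: W_def U(3))
    finally show ?thesis by (simp add: total)
  qed
  moreover have "W i \<in> M \<and> norm (W i) \<le> 1" for i
    using VM U by (simp add: W_def)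
  ultimately show ?thesis by blast
qed

text \<open>
  Projections in the kernel of \<open>\<tau>\<close> would have compressions of trace \<open>0\<close> only, and finitely many of these
  add up to the identity.
\<close>

lemma tr_faithful:
  assumes Q: "Q \<in> projections M" "Q \<noteq> 0"
  shows "0 < tr Q"
proof -
  obtain k and V :: "nat \<Rightarrow> _" where V: "\<And>i. V i \<in> M" "\<And>i. norm (V i) \<le> 1"
    and total: "(\<Sum>i\<le>k. V i o\<^sub>L (Q o\<^sub>L adj (V i))) = id_blinfun"
    using finite_cover[OF Q] by blast
  have "1 = (\<Sum>i\<le>k. tr (V i o\<^sub>L (Q o\<^sub>L adj (V i))))"
    using tr_sum[of "{..k}" "\<lambda>i. V i o\<^sub>L (Q o\<^sub>L adj (V i))"] V(1) projD(1)[OF Q(1)]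
    by (simp add: total tr_id)
  also have "\<dots> \<le> (\<Sum>i\<le>k. tr Q)"
    by (intro sum_mono tr_compression_le V Q)
  finally have "1 \<le> (1 + real k) * tr Q" by simp
  then show ?thesis
    by (smt (verit) mult_nonneg_nonpos of_nat_0_le_iff)
qed

end

section \<open>Unitarily invariant norms\<close>

context von_neumann
begin

lemma id_unitary: "id_blinfun \<in> unitaries M"
  by (simp add: unitaries_def adj_id blinfun_eq_iff)

text \<open>
  Real and imaginary part of \<open>A / \<parallel>A\<parallel>\<close> are self-adjoint contractions, each the mean of two unitaries.
\<close>

lemma four_unitaries:
  assumes A: "A \<in> M"
  shows "\<exists>U\<in>unitaries M. \<exists>V\<in>unitaries M. \<exists>U'\<in>unitaries M. \<exists>V'\<in>unitaries M.
    A = (norm A / 2) *\<^sub>R ((U + V) + scale_op \<i> (U' + V'))"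
proof (cases "A = 0")
  case True
  then show ?thesis using id_unitary by auto
next
  case False
  define r where "r = norm A"
  have r: "0 < r" using False by (simp add: r_def)
  have adj_le: "norm (adj A) \<le> r"
    using norm_adj_le[OF bounded[OF A]] by (simp add: r_def)
  define H where "H = (1 / (2 * r)) *\<^sub>R (A + adj A)"
  define K where "K = scale_op (- \<i>) ((1 / (2 * r)) *\<^sub>R (A - adj A))"
  have bounds: "norm (A + adj A) \<le> 2 * r" "norm (A - adj A) \<le> 2 * r"
    using adj_le norm_triangle_ineq[of A "adj A"] norm_triangle_ineq4[of A "adj A"]
    by (simp_all add: r_def)
  have M: "H \<in> M" "K \<in> M" using A by (simp_all add: H_def K_def)
  have "norm H = norm (A + adj A) / (2 * r)" "norm K = norm (A - adj A) / (2 * r)"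
    using r by (simp_all add: H_def K_def norm_scale_op del: scaleR_add_right scaleR_diff_right)
  then have "norm H \<le> 1" "norm K \<le> 1"
    using bounds r by (simp_all add: divide_le_eq)
  moreover have "adj H = H"
    using A by (simp add: H_def scaleR_op adj_scale_op adj_add bounded bounded_ops_intros
        adj_bounded_ops adj_adj add.commute)
  moreover have "adj K = K"
  proof -
    have "adj K = scale_op \<i> ((1 / (2 * r)) *\<^sub>R (adj A - A))"
      using A by (simp add: K_def scaleR_op adj_scale_op adj_diff bounded bounded_ops_intros
          bounded_ops_diff adj_bounded_ops adj_adj)
    also have "\<dots> = K"
      by (rule blinfun_eqI)
        (simp add: K_def scale_op.rep_eq blinfun.bilinear_simps scaleC_minus_left scaleC_diff_right
          scaleR_diff_right)
    finally show ?thesis .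
  qed
  ultimately obtain U V U' V' where U: "U \<in> unitaries M" "V \<in> unitaries M"
      "U' \<in> unitaries M" "V' \<in> unitaries M" and sums: "U + V = 2 *\<^sub>R H" "U' + V' = 2 *\<^sub>R K"
    using selfadjoint_contraction_unitary M by metis
  have "A = (r / 2) *\<^sub>R (2 *\<^sub>R H + scale_op \<i> (2 *\<^sub>R K))"
  proof (rule blinfun_eqI)
    fix x
    have half: "y = (1/2) *\<^sub>R (y + z) + (1/2) *\<^sub>R (y - z)" for y z :: 'h
      by (simp add: algebra_simps flip: scaleR_add_left)
    have "\<i> *\<^sub>C (- \<i>) *\<^sub>C y = y" for y :: 'h
      using scaleC_of_real[of 1 y] by (simp add: scaleC_scaleC)
    then have "((r / 2) *\<^sub>R (2 *\<^sub>R H + scale_op \<i> (2 *\<^sub>R K))) x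
        = (1/2) *\<^sub>R (A x + adj A x) + (1/2) *\<^sub>R (A x - adj A x)"
      using r by (simp add: H_def K_def scale_op.rep_eq blinfun.add_left blinfun.diff_left
          blinfun.scaleR_left scaleR_add_right scaleC_scaleR)
    then show "A x = ((r / 2) *\<^sub>R (2 *\<^sub>R H + scale_op \<i> (2 *\<^sub>R K))) x"
      using half[of "A x" "adj A x"] by simp
  qed
  then show ?thesis
    using U unfolding sums[symmetric] r_def by blast
qed

end

locale unitarily_invariant_II1 = II1_factor M \<tau>
  for M :: "('h::chilbert_space \<Rightarrow>\<^sub>L 'h) set" and \<tau> :: "('h \<Rightarrow>\<^sub>L 'h) \<Rightarrow> complex" +
  fixes N :: "('h \<Rightarrow>\<^sub>L 'h) \<Rightarrow> real"
  assumes N: "unitarily_invariant_norm M N"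
begin

lemma N_nonneg: "T \<in> M \<Longrightarrow> 0 \<le> N T"
  and N_zero_iff: "T \<in> M \<Longrightarrow> N T = 0 \<longleftrightarrow> T = 0"
  and N_add: "S \<in> M \<Longrightarrow> T \<in> M \<Longrightarrow> N (S + T) \<le> N S + N T"
  and N_scale: "T \<in> M \<Longrightarrow> N (scale_op c T) = cmod c * N T"
  and N_unitary: "T \<in> M \<Longrightarrow> U \<in> unitaries M \<Longrightarrow> V \<in> unitaries M \<Longrightarrow> N (U o\<^sub>L T o\<^sub>L V) = N T"
  using N by (simp_all add: unitarily_invariant_norm_def)

lemma N_scaleR: "T \<in> M \<Longrightarrow> N (r *\<^sub>R T) = \<bar>r\<bar> * N T"
  by (simp add: scaleR_op N_scale)

lemma unitary_mem: "U \<in> unitaries M \<Longrightarrow> U \<in> M"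
  by (simp add: unitaries_def)

lemma N_unitary_left: "T \<in> M \<Longrightarrow> U \<in> unitaries M \<Longrightarrow> N (U o\<^sub>L T) = N T"
  using N_unitary[of T U id_blinfun] id_unitary by (simp add: blinfun_compose_id_right)

lemma N_unitary_right: "T \<in> M \<Longrightarrow> U \<in> unitaries M \<Longrightarrow> N (T o\<^sub>L U) = N T"
  using N_unitary[of T id_blinfun U] id_unitary by (simp add: blinfun_compose_id_left)

lemma N_four_terms:
  assumes "A \<in> M" "B \<in> M" "C \<in> M" "D \<in> M" and "N A = s" "N B = s" "N C = s" "N D = s"
    and "0 \<le> r"
  shows "N ((r / 2) *\<^sub>R ((A + B) + scale_op \<i> (C + D))) \<le> 2 * r * s"
proof -
  have "N ((A + B) + scale_op \<i> (C + D)) \<le> N (A + B) + N (C + D)"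
    using assms N_add[of "A + B" "scale_op \<i> (C + D)"] by (simp add: N_scale)
  also have "\<dots> \<le> 4 * s"
    using assms N_add[of A B] N_add[of C D] by simp
  finally have "r / 2 * N ((A + B) + scale_op \<i> (C + D)) \<le> r / 2 * (4 * s)"
    using \<open>0 \<le> r\<close> by (intro mult_left_mono) auto
  then show ?thesis
    using assms by (simp add: N_scaleR)
qed

lemma N_comp_le:
  assumes A: "A \<in> M" and T: "T \<in> M"
  shows "N (A o\<^sub>L T) \<le> 2 * norm A * N T" "N (T o\<^sub>L A) \<le> 2 * norm A * N T"
proof -
  obtain U V U' V' where U: "U \<in> unitaries M" "V \<in> unitaries M"
      "U' \<in> unitaries M" "V' \<in> unitaries M"
    and A_eq: "A = (norm A / 2) *\<^sub>R ((U + V) + scale_op \<i> (U' + V'))"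
    using four_unitaries[OF A] by blast
  have "A o\<^sub>L T = (norm A / 2) *\<^sub>R (((U o\<^sub>L T) + (V o\<^sub>L T)) + scale_op \<i> ((U' o\<^sub>L T) + (V' o\<^sub>L T)))"
    by (subst A_eq, rule blinfun_eqI) (simp add: blinfun.bilinear_simps scale_op.rep_eq)
  then show "N (A o\<^sub>L T) \<le> 2 * norm A * N T"
    using U T by (auto intro!: N_four_terms simp: unitary_mem N_unitary_left)
  have "T (c *\<^sub>C x) = c *\<^sub>C T x" for c x
    using bounded[OF T] by (simp add: bounded_ops_def)
  then have "T o\<^sub>L A = (norm A / 2) *\<^sub>R (((T o\<^sub>L U) + (T o\<^sub>L V)) + scale_op \<i> ((T o\<^sub>L U') + (T o\<^sub>L V')))"
    by (subst A_eq, intro blinfun_eqI)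
      (simp add: blinfun.bilinear_simps scale_op.rep_eq scaleC_add_right)
  then show "N (T o\<^sub>L A) \<le> 2 * norm A * N T"
    using U T by (auto intro!: N_four_terms simp: unitary_mem N_unitary_right)
qed

lemma N_le_norm: "T \<in> M \<Longrightarrow> N T \<le> 2 * N id_blinfun * norm T"
  using N_comp_le(1)[of T id_blinfun] by (simp add: blinfun_compose_id_right mult_ac)

lemma N_id_pos: "0 < N id_blinfun"
  using N_nonneg[OF id_mem] N_zero_iff[OF id_mem] factor by (simp add: factor_def less_le)

text \<open>
  Each of the \<open>k + 1\<close> pieces covering the identity has \<open>N\<close> at most \<open>4 N(Q)\<close>, and
  \<open>(k + 1) \<tau>(Q) \<le> 2\<close>.
\<close>

lemma tr_le_N:
  assumes Q: "Q \<in> projections M"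
  shows "tr Q * N id_blinfun \<le> 8 * N Q"
proof (cases "Q = 0")
  case True
  then show ?thesis
    using N_nonneg[OF zero_mem] tr_diff[of 0 0] by simp
next
  case False
  have QM: "Q \<in> M" by (rule projD(1)[OF Q])
  obtain k and V :: "nat \<Rightarrow> _" where V: "\<And>i. V i \<in> M" "\<And>i. norm (V i) \<le> 1"
    and k: "real k * tr Q \<le> 1" and total: "(\<Sum>i\<le>k. V i o\<^sub>L (Q o\<^sub>L adj (V i))) = id_blinfun"
    using finite_cover[OF Q False] by blast
  have piece: "N (V i o\<^sub>L (Q o\<^sub>L adj (V i))) \<le> 4 * N Q" for i
  proof -
    have "N (V i o\<^sub>L (Q o\<^sub>L adj (V i))) \<le> 2 * norm (V i) * N (Q o\<^sub>L adj (V i))"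
      using V(1) QM by (intro N_comp_le) auto
    also have "\<dots> \<le> 2 * 1 * N (Q o\<^sub>L adj (V i))"
      using V QM by (intro mult_right_mono mult_left_mono N_nonneg) auto
    also have "N (Q o\<^sub>L adj (V i)) \<le> 2 * norm (adj (V i)) * N Q"
      using V(1) QM by (intro N_comp_le) auto
    also have "\<dots> \<le> 2 * 1 * N Q"
      using V order_trans[OF norm_adj_le[OF bounded[OF V(1)]] V(2), of i] QM
      by (intro mult_right_mono mult_left_mono N_nonneg) auto
    finally show ?thesis by simp
  qed
  have "N (\<Sum>i\<in>I. V i o\<^sub>L (Q o\<^sub>L adj (V i))) \<le> real (card I) * (4 * N Q)" if "finite I" for I
    using that
  proof (induction I rule: finite_induct)
    case empty
    then show ?case using N_zero_iff[of 0] by simp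
  next
    case (insert i I)
    have "N (\<Sum>i\<in>insert i I. V i o\<^sub>L (Q o\<^sub>L adj (V i)))
        \<le> N (V i o\<^sub>L (Q o\<^sub>L adj (V i))) + N (\<Sum>i\<in>I. V i o\<^sub>L (Q o\<^sub>L adj (V i)))"
      using insert V QM by (simp add: N_add)
    then show ?case
      using insert piece[of i] by (simp add: algebra_simps)
  qed
  from this[of "{..k}"] have "N id_blinfun \<le> (real k + 1) * (4 * N Q)"
    by (simp add: total algebra_simps)
  then have "tr Q * N id_blinfun \<le> tr Q * ((real k + 1) * (4 * N Q))"
    using tr_proj_nonneg[OF Q] by (rule mult_left_mono)
  also have "\<dots> = (real k * tr Q + tr Q) * (4 * N Q)"
    by (simp add: algebra_simps)
  also have "\<dots> \<le> 2 * (4 * N Q)"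
    using k tr_proj_le_1[OF Q] N_nonneg[OF QM] by (intro mult_right_mono) auto
  finally show ?thesis by simp
qed

text \<open>
  Chebyshev's inequality for \<open>N\<close>: \<open>Q = Z T Q\<close> with a bounded left inverse \<open>Z\<close> compares \<open>N(Q)\<close> with \<open>N(T)\<close>.
\<close>

lemma spectral_projection_N:
  assumes T: "T \<in> M" and \<mu>: "0 < \<mu>"
  shows "\<exists>Q\<in>projections M. norm (T o\<^sub>L (id_blinfun - Q)) \<le> \<mu> \<and> N Q \<le> 4 * norm T / \<mu>\<^sup>2 * N T"
proof -
  obtain Q where Q: "Q \<in> projections M" and above: "\<And>x. Q x = x \<Longrightarrow> \<mu> * norm x \<le> norm (T x)"
    and below: "\<And>x. Q x = 0 \<Longrightarrow> norm (T x) \<le> \<mu> * norm x"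
    using spectral_projection[OF T, of \<mu>] \<mu> by auto
  have QM: "Q \<in> M" by (rule projD(1)[OF Q])
  have "norm (T o\<^sub>L (id_blinfun - Q)) \<le> \<mu>"
  proof (rule norm_blinfun_bound)
    fix x
    have "id_blinfun - Q \<in> projections M"
      using proj_diff(1)[OF id_proj Q] by (simp add: blinfun_compose_id_left)
    then have "norm ((id_blinfun - Q) x) \<le> norm x"
      by (rule proj_norm_apply_le)
    moreover have "Q ((id_blinfun - Q) x) = 0"
      by (simp add: blinfun.bilinear_simps projD(5)[OF Q])
    ultimately show "norm ((T o\<^sub>L (id_blinfun - Q)) x) \<le> \<mu> * norm x"
      using below[of "(id_blinfun - Q) x"] \<mu>
      by (simp add: order_trans[OF _ mult_left_mono])
  qed (use \<mu> in simp)
  moreover have "N Q \<le> 4 * norm T / \<mu>\<^sup>2 * N T"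
  proof -
    obtain Z where Z: "Z \<in> M" "norm Z \<le> norm T / \<mu>\<^sup>2" "Z o\<^sub>L (T o\<^sub>L Q) = Q"
      using left_inverse_on_projection[OF T Q \<mu> above] by blast
    have "N Q \<le> 2 * norm Z * N (T o\<^sub>L Q)"
      using N_comp_le(1)[OF Z(1), of "T o\<^sub>L Q"] T QM by (simp add: Z(3))
    also have "\<dots> \<le> 2 * (norm T / \<mu>\<^sup>2) * N (T o\<^sub>L Q)"
      using Z T QM by (intro mult_right_mono mult_left_mono N_nonneg) auto
    also have "\<dots> \<le> 2 * (norm T / \<mu>\<^sup>2) * (2 * N T)"
    proof (intro mult_left_mono)
      have "N (T o\<^sub>L Q) \<le> 2 * norm Q * N T"
        by (rule N_comp_le(2)[OF QM T])
      also have "\<dots> \<le> 2 * 1 * N T"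
        using proj_norm_le[OF Q] N_nonneg[OF T] by (intro mult_right_mono mult_left_mono) auto
      finally show "N (T o\<^sub>L Q) \<le> 2 * N T" by simp
    qed simp
    finally show ?thesis by simp
  qed
  ultimately show ?thesis using Q by blast
qed

text \<open>
  Faithfulness of the trace turns the filter condition \<open>\<tau>(E) \<rightarrow> 0+\<close> into smallness of \<open>\<tau>(E)\<close> alone.
\<close>

lemma eventually_small_projections:
  assumes "eventually P (small_projections M \<tau>)"
  shows "\<exists>\<delta>>0. \<forall>E\<in>projections M. E \<noteq> 0 \<longrightarrow> tr E < \<delta> \<longrightarrow> P E"
proof -
  have "eventually (\<lambda>E. E \<in> projections M - {0} \<longrightarrow> P E) (filtercomap (\<lambda>E. Re (\<tau> E)) (at_right 0))"
    using assms by (simp add: small_projections_def eventually_inf_principal)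
  then obtain R where R: "eventually R (at_right (0::real))"
    and RP: "\<And>E. R (Re (\<tau> E)) \<Longrightarrow> E \<in> projections M - {0} \<longrightarrow> P E"
    unfolding eventually_filtercomap by blast
  obtain \<delta> where \<delta>: "\<delta> > 0" "\<And>t. 0 < t \<Longrightarrow> t < \<delta> \<Longrightarrow> R t"
    using R unfolding eventually_at_right_field by blast
  have "P E" if "E \<in> projections M" "E \<noteq> 0" "tr E < \<delta>" for E
    using \<delta>(2)[of "tr E"] tr_faithful[OF that(1,2)] that RP[of E] by (simp add: tr_def)
  with \<delta>(1) show ?thesis by blast
qed

section \<open>Singular norms\<close>

text \<open>
  A proper nonzero subprojection \<open>G\<close> of \<open>F\<close> or its complement \<open>F - G\<close> has at most half the trace of \<open>F\<close>.
\<close>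

lemma small_subprojection:
  assumes E: "E \<in> projections M" "E \<noteq> 0" and "0 < \<delta>"
  shows "\<exists>F\<in>projections M. F \<noteq> 0 \<and> F o\<^sub>L E = F \<and> tr F < \<delta>"
proof -
  have step: "\<exists>F\<in>projections M. F \<noteq> 0 \<and> F o\<^sub>L E = F \<and> tr F \<le> (1/2) ^ n" for n
  proof (induction n)
    case 0
    have "E o\<^sub>L E = E" using projD(4)[OF E(1)] .
    then show ?case using E tr_proj_le_1[OF E(1)] by auto
  next
    case (Suc n)
    then obtain F where F: "F \<in> projections M" "F \<noteq> 0" "F o\<^sub>L E = F" "tr F \<le> (1/2) ^ n"
      by blast
    obtain G where G: "G \<in> projections M" "G \<noteq> 0" "G \<noteq> F" "F o\<^sub>L G = G"
      using no_minimal[OF F(1,2)] by blast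
    note FG = proj_diff[OF F(1) G(1,4)]
    have GE: "G o\<^sub>L E = G"
      using FG(2) F(3) by (metis blinfun_compose_assoc)
    have "(F - G) o\<^sub>L E = (F o\<^sub>L E) - (G o\<^sub>L E)"
      by (rule blinfun_eqI) (simp add: blinfun.diff_left)
    then have FGE: "(F - G) o\<^sub>L E = F - G"
      by (simp add: GE F(3))
    have "tr G + tr (F - G) = tr F"
      using F(1) G(1) by (simp add: tr_diff projD(1))
    moreover have "(1/2 :: real) ^ Suc n = (1/2) ^ n / 2"
      by simp
    ultimately have "tr G \<le> (1/2) ^ Suc n \<or> tr (F - G) \<le> (1/2) ^ Suc n"
      using F(4) by linarith
    then show ?case
      using G FG(1) GE FGE by (metis right_minus_eq)
  qed
  obtain n where "(1/2 :: real) ^ n < \<delta>"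
    using real_arch_pow_inv[of \<delta> "1/2"] \<open>0 < \<delta>\<close> by auto
  with step[of n] show ?thesis by force
qed

lemma singular_lower_bound:
  assumes "singular_norm M \<tau> N"
  shows "\<exists>c>0. \<forall>T\<in>M. c * norm T \<le> N T"
proof -
  obtain L where L: "0 < L" "(N \<longlongrightarrow> L) (small_projections M \<tau>)"
    using assms unfolding singular_norm_def by blast
  have "eventually (\<lambda>E. L / 2 < N E) (small_projections M \<tau>)"
    using L by (intro order_tendstoD(1)[OF L(2)]) simp
  from eventually_small_projections[OF this]
  obtain \<delta> where \<delta>: "\<delta> > 0"
    and small: "\<And>E. E \<in> projections M \<Longrightarrow> E \<noteq> 0 \<Longrightarrow> tr E < \<delta> \<Longrightarrow> L / 2 < N E"
    by blast
  have proj: "L / 4 \<le> N E" if E: "E \<in> projections M" "E \<noteq> 0" for E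
  proof -
    obtain F where F: "F \<in> projections M" "F \<noteq> 0" "F o\<^sub>L E = F" "tr F < \<delta>"
      using small_subprojection[OF E \<delta>] by blast
    have "L / 2 < N F" using small F by blast
    also have "N F \<le> 2 * norm F * N E"
      using N_comp_le(1)[of F E] F E by (simp add: projD(1))
    also have "\<dots> \<le> 2 * 1 * N E"
      using proj_norm_le[OF F(1)] N_nonneg[OF projD(1)[OF E(1)]]
      by (intro mult_right_mono mult_left_mono) auto
    finally show ?thesis by simp
  qed
  have "L / 64 * norm T \<le> N T" if T: "T \<in> M" for T
  proof (cases "T = 0")
    case True
    then show ?thesis using N_nonneg[OF T] by simp
  next
    case False
    then have pos: "0 < norm T" by simp
    obtain Q where Q: "Q \<in> projections M" "norm (T o\<^sub>L (id_blinfun - Q)) \<le> norm T / 2"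
        "N Q \<le> 4 * norm T / (norm T / 2)\<^sup>2 * N T"
      using spectral_projection_N[OF T, of "norm T / 2"] pos by auto
    have "Q \<noteq> 0"
      using Q(2) pos by (auto simp: blinfun_compose_id_right)
    then have "L / 4 \<le> 4 * norm T / (norm T / 2)\<^sup>2 * N T"
      using proj[OF Q(1)] Q(3) by simp
    then show ?thesis
      using pos by (simp add: power2_eq_square field_simps)
  qed
  then show ?thesis
    using L(1) by (intro exI[of _ "L / 64"]) auto
qed

lemma openin_norm_topology_ball:
  "openin (subtopology (norm_topology M N) (op_unit_ball M)) S \<longleftrightarrow>
    S \<subseteq> op_unit_ball M \<and> (\<forall>x\<in>S. \<exists>r>0. \<forall>y\<in>op_unit_ball M. N (y - x) < r \<longrightarrow> y \<in> S)"
proof -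
  interpret Metric_space M "norm_dist M N"
    by (rule Metric_space_norm_dist[OF vn N])
  interpret B: Submetric M "norm_dist M N" "op_unit_ball M"
    by unfold_locales (auto simp: op_unit_ball_def)
  have ball: "y \<in> B.sub.mball x r \<longleftrightarrow> y \<in> op_unit_ball M \<and> N (y - x) < r"
    if x: "x \<in> op_unit_ball M" for x y r
  proof -
    have "norm_dist M N x y = N (y - x)" if "y \<in> op_unit_ball M"
      using that x commute[of x y] by (simp add: norm_dist_def op_unit_ball_def)
    then show ?thesis
      using x unfolding B.sub.in_mball by auto
  qed
  have "openin (subtopology (norm_topology M N) (op_unit_ball M)) S \<longleftrightarrow> openin B.sub.mtopology S"
    by (simp add: norm_topology_def B.mtopology_submetric)
  also have "\<dots> \<longleftrightarrow> S \<subseteq> op_unit_ball M \<and> (\<forall>x\<in>S. \<exists>r>0. B.sub.mball x r \<subseteq> S)"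
    unfolding B.sub.openin_mtopology by blast
  also have "\<dots> \<longleftrightarrow> S \<subseteq> op_unit_ball M \<and> (\<forall>x\<in>S. \<exists>r>0. \<forall>y\<in>op_unit_ball M. N (y - x) < r \<longrightarrow> y \<in> S)"
  proof (intro conj_cong refl ball_cong)
    fix x assume "S \<subseteq> op_unit_ball M" "x \<in> S"
    then have "x \<in> op_unit_ball M" by blast
    then show "(\<exists>r>0. B.sub.mball x r \<subseteq> S)
        \<longleftrightarrow> (\<exists>r>0. \<forall>y\<in>op_unit_ball M. N (y - x) < r \<longrightarrow> y \<in> S)"
      by (simp add: subset_iff ball del: B.sub.in_mball) blast
  qed
  finally show ?thesis .
qed

theorem singular_topology:
  assumes "singular_norm M \<tau> N"
  shows "subtopology (norm_topology M N) (op_unit_ball M) = top_of_set (op_unit_ball M)"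
proof -
  obtain c where c: "c > 0" and lower: "\<And>T. T \<in> M \<Longrightarrow> c * norm T \<le> N T"
    using singular_lower_bound[OF assms] by blast
  define k where "k = 2 * N id_blinfun"
  have k: "k > 0" and upper: "\<And>T. T \<in> M \<Longrightarrow> N T \<le> k * norm T"
    using N_id_pos N_le_norm by (auto simp: k_def)
  have diff: "y - x \<in> M" if "x \<in> op_unit_ball M" "y \<in> op_unit_ball M" for x y
    using that by (simp add: op_unit_ball_def)
  have "(\<exists>r>0. \<forall>y\<in>op_unit_ball M. N (y - x) < r \<longrightarrow> y \<in> S)
    \<longleftrightarrow> (\<exists>e>0. \<forall>y\<in>op_unit_ball M. dist y x < e \<longrightarrow> y \<in> S)"
    if x: "x \<in> op_unit_ball M" for x S
  proof
    assume "\<exists>r>0. \<forall>y\<in>op_unit_ball M. N (y - x) < r \<longrightarrow> y \<in> S"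
    then obtain r where r: "r > 0" "\<And>y. y \<in> op_unit_ball M \<Longrightarrow> N (y - x) < r \<Longrightarrow> y \<in> S" by blast
    have "y \<in> S" if y: "y \<in> op_unit_ball M" "dist y x < r / k" for y
    proof (rule r(2)[OF y(1)])
      have "N (y - x) \<le> k * norm (y - x)" by (rule upper[OF diff[OF x y(1)]])
      also have "\<dots> < r" using y(2) k by (simp add: dist_norm field_simps)
      finally show "N (y - x) < r" .
    qed
    then show "\<exists>e>0. \<forall>y\<in>op_unit_ball M. dist y x < e \<longrightarrow> y \<in> S"
      using r(1) k by (intro exI[of _ "r / k"]) auto
  next
    assume "\<exists>e>0. \<forall>y\<in>op_unit_ball M. dist y x < e \<longrightarrow> y \<in> S"
    then obtain e where e: "e > 0" "\<And>y. y \<in> op_unit_ball M \<Longrightarrow> dist y x < e \<Longrightarrow> y \<in> S" by blast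
    have "y \<in> S" if y: "y \<in> op_unit_ball M" "N (y - x) < c * e" for y
    proof (rule e(2)[OF y(1)])
      have "c * norm (y - x) < c * e" using lower[OF diff[OF x y(1)]] y(2) by simp
      then show "dist y x < e" using c by (simp add: dist_norm)
    qed
    then show "\<exists>r>0. \<forall>y\<in>op_unit_ball M. N (y - x) < r \<longrightarrow> y \<in> S"
      using e(1) c by (intro exI[of _ "c * e"]) auto
  qed
  then show ?thesis
    unfolding topology_eq openin_norm_topology_ball openin_euclidean_subtopology_iff by blast
qed

section \<open>Continuous norms\<close>

lemma measure_nbhd_of_N_small:
  assumes "0 < \<epsilon>" "0 < \<delta>"
  shows "\<exists>r>0. \<forall>T\<in>M. norm T \<le> 2 \<longrightarrow> N T < r \<longrightarrow> T \<in> measure_nbhd M \<tau> \<epsilon> \<delta>"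
proof -
  define \<mu> where "\<mu> = \<epsilon> / 2"
  have \<mu>: "0 < \<mu>" "\<mu> < \<epsilon>" using assms by (auto simp: \<mu>_def)
  \<comment> \<open>The constant \<open>64\<close> is \<open>8 \<cdot> 4 \<cdot> 2\<close>, from \<open>\<tau>(Q) N(1) \<le> 8 N(Q)\<close>, \<open>N(Q) \<le> 4 \<parallel>T\<parallel> N(T) / \<mu>\<^sup>2\<close> and \<open>\<parallel>T\<parallel> \<le> 2\<close>.\<close>
  define r where "r = \<delta> * N id_blinfun * \<mu>\<^sup>2 / 64"
  have "r > 0" using assms \<mu> N_id_pos by (simp add: r_def)
  moreover have "T \<in> measure_nbhd M \<tau> \<epsilon> \<delta>" if T: "T \<in> M" "norm T \<le> 2" "N T < r" for T
  proof -
    obtain Q where Q: "Q \<in> projections M" "norm (T o\<^sub>L (id_blinfun - Q)) \<le> \<mu>"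
        "N Q \<le> 4 * norm T / \<mu>\<^sup>2 * N T"
      using spectral_projection_N[OF T(1) \<mu>(1)] by blast
    have "tr Q * N id_blinfun \<le> 8 * N Q" by (rule tr_le_N[OF Q(1)])
    also have "\<dots> \<le> 8 * (4 * norm T / \<mu>\<^sup>2 * N T)" using Q(3) by simp
    also have "\<dots> \<le> 8 * (4 * 2 / \<mu>\<^sup>2 * N T)"
      using T N_nonneg[OF T(1)] by (intro mult_left_mono mult_right_mono divide_right_mono) auto
    also have "\<dots> < 8 * (4 * 2 / \<mu>\<^sup>2 * r)"
      using T(3) \<mu> by (intro mult_strict_left_mono) auto
    also have "\<dots> = \<delta> * N id_blinfun"
      using \<mu> by (simp add: r_def)
    finally have "tr Q < \<delta>"
      using N_id_pos by simp
    then show ?thesis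
      using T(1) Q \<mu> unfolding measure_nbhd_def tr_def by force
  qed
  ultimately show ?thesis by blast
qed

lemma N_small_of_measure_nbhd:
  assumes cont: "continuous_norm M \<tau> N" and r: "0 < r"
  shows "\<exists>\<epsilon>>0. \<exists>\<delta>>0. \<forall>T\<in>measure_nbhd M \<tau> \<epsilon> \<delta>. norm T \<le> 2 \<longrightarrow> N T < r"
proof -
  have "eventually (\<lambda>E. N E < r / 8) (small_projections M \<tau>)"
    using cont r unfolding continuous_norm_def by (intro order_tendstoD(2)) auto
  from eventually_small_projections[OF this]
  obtain \<delta> where \<delta>: "\<delta> > 0"
    and small: "\<And>E. E \<in> projections M \<Longrightarrow> E \<noteq> 0 \<Longrightarrow> tr E < \<delta> \<Longrightarrow> N E < r / 8"
    by blast
  define \<epsilon> where "\<epsilon> = r / (4 * N id_blinfun)"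
  have "\<epsilon> > 0" using r N_id_pos by (simp add: \<epsilon>_def)
  moreover have "N T < r" if T: "T \<in> measure_nbhd M \<tau> \<epsilon> \<delta>" "norm T \<le> 2" for T
  proof -
    obtain E where TM: "T \<in> M" and E: "E \<in> projections M" "tr E < \<delta>" "norm (T o\<^sub>L (id_blinfun - E)) < \<epsilon>"
      using T(1) unfolding measure_nbhd_def tr_def by blast
    have EM: "E \<in> M" by (rule projD(1)[OF E(1)])
    have "N E < r / 8"
      using small[OF E(1) _ E(2)] N_zero_iff[of 0] r by (cases "E = 0") auto
    moreover have "T = (T o\<^sub>L E) + (T o\<^sub>L (id_blinfun - E))"
      by (rule blinfun_eqI) (simp add: blinfun.bilinear_simps)
    then have "N T \<le> N (T o\<^sub>L E) + N (T o\<^sub>L (id_blinfun - E))"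
      using N_add[of "T o\<^sub>L E" "T o\<^sub>L (id_blinfun - E)"] TM EM by simp
    moreover have "N (T o\<^sub>L E) \<le> 2 * 2 * N E"
      by (rule order_trans[OF N_comp_le(1)[OF TM EM]])
        (use T(2) N_nonneg[OF EM] in \<open>intro mult_right_mono, auto\<close>)
    moreover have "N (T o\<^sub>L (id_blinfun - E)) < 2 * N id_blinfun * \<epsilon>"
      by (rule order_le_less_trans[OF N_le_norm]) (use TM EM E(3) N_id_pos in auto)
    moreover have "2 * N id_blinfun * \<epsilon> = r / 2"
      using N_id_pos by (simp add: \<epsilon>_def)
    ultimately show ?thesis by linarith
  qed
  ultimately show ?thesis using \<delta> by blast
qed

text \<open>
  Let \<open>Q\<close> be the spectral projection of \<open>|T|\<close> above some \<open>\<mu>\<close> between \<open>1\<close> and \<open>\<parallel>T\<parallel>\<close>. If a contraction \<open>S\<close>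
  is within \<open>\<epsilon>\<close> of \<open>T\<close> off \<open>E\<close>, then for \<open>x\<close> in the range of \<open>Q\<close>
  \<open>\<mu> \<parallel>x\<parallel> \<le> \<parallel>T x\<parallel> \<le> (1 + \<epsilon>) \<parallel>x\<parallel> + \<parallel>T\<parallel> \<parallel>E x\<parallel>\<close>,
  so \<open>E\<close> is bounded below on the range of \<open>Q\<close>. Its left inverse there shows that \<open>\<tau>(Q)\<close> is at most a
  constant times \<open>\<tau>(Q E Q) \<le> \<tau>(E)\<close>, which excludes projections \<open>E\<close> of small trace.
\<close>

lemma unit_ball_measure_closed:
  assumes T: "T \<in> M" "1 < norm T"
  shows "\<exists>\<epsilon>>0. \<exists>\<delta>>0. \<forall>S\<in>op_unit_ball M. S - T \<notin> measure_nbhd M \<tau> \<epsilon> \<delta>"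
proof -
  define \<mu> where "\<mu> = (1 + norm T) / 2"
  have \<mu>: "1 < \<mu>" "\<mu> < norm T" using T by (auto simp: \<mu>_def)
  obtain Q where Q: "Q \<in> projections M" and above: "\<And>x. Q x = x \<Longrightarrow> \<mu> * norm x \<le> norm (T x)"
    and below: "\<And>x. Q x = 0 \<Longrightarrow> norm (T x) \<le> \<mu> * norm x"
    using spectral_projection[OF T(1), of \<mu>] \<mu> by auto
  have "Q \<noteq> 0"
  proof
    assume "Q = 0"
    then have "norm T \<le> \<mu>"
      using below \<mu> by (intro norm_blinfun_bound) auto
    then show False using \<mu> by simp
  qed
  then have trQ: "0 < tr Q" by (rule tr_faithful[OF Q])
  \<comment> \<open>Half of the gap \<open>\<mu> - 1\<close> goes to the error off \<open>E\<close>, the other half bounds \<open>\<parallel>T\<parallel> \<parallel>E x\<parallel>\<close> from below.\<close>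
  define \<epsilon> where "\<epsilon> = (\<mu> - 1) / 2"
  have \<epsilon>: "0 < \<epsilon>" using \<mu> by (simp add: \<epsilon>_def)
  define c where "c = \<epsilon> / norm T"
  have c: "0 < c" unfolding c_def using \<epsilon> T by (intro divide_pos_pos) linarith+
  define \<delta> where "\<delta> = tr Q / (1 / c\<^sup>2)\<^sup>2"
  have \<delta>: "0 < \<delta>" using trQ c by (simp add: \<delta>_def)
  have "S - T \<notin> measure_nbhd M \<tau> \<epsilon> \<delta>" if S: "S \<in> op_unit_ball M" for S
  proof
    assume "S - T \<in> measure_nbhd M \<tau> \<epsilon> \<delta>"
    then obtain E where E: "E \<in> projections M" "tr E < \<delta>"
      and close: "norm ((S - T) o\<^sub>L (id_blinfun - E)) < \<epsilon>"
      unfolding measure_nbhd_def tr_def by blast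
    have EM: "E \<in> M" "Q \<in> M" by (rule projD(1)[OF E(1)], rule projD(1)[OF Q])
    have E': "id_blinfun - E \<in> projections M"
      using proj_diff(1)[OF id_proj E(1)] by (simp add: blinfun_compose_id_left)
    have "c * norm x \<le> norm (E x)" if x: "Q x = x" for x
    proof -
      define u where "u = (id_blinfun - E) x"
      have u: "norm u \<le> norm x"
        unfolding u_def by (rule proj_norm_apply_le[OF E'])
      have Tx: "T x = S u - (S - T) u + T (E x)"
        by (simp add: u_def blinfun.bilinear_simps)
      have "norm (T x) \<le> norm (S u) + norm ((S - T) u) + norm (T (E x))"
        unfolding Tx using norm_triangle_ineq[of "S u - (S - T) u" "T (E x)"]
          norm_triangle_ineq4[of "S u" "(S - T) u"] by linarith
      moreover have "norm (S u) \<le> 1 * norm x"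
        by (rule order_trans[OF norm_blinfun mult_mono']) (use S u in \<open>auto simp: op_unit_ball_def\<close>)
      moreover have "norm ((S - T) u) \<le> \<epsilon> * norm x"
        using norm_blinfun[of "(S - T) o\<^sub>L (id_blinfun - E)" x]
          mult_right_mono[OF less_imp_le[OF close] norm_ge_zero[of x]] by (simp add: u_def)
      moreover have "norm (T (E x)) \<le> norm T * norm (E x)"
        by (rule norm_blinfun)
      moreover have "\<mu> * norm x \<le> norm (T x)" by (rule above[OF x])
      moreover have "\<mu> * norm x = 1 * norm x + \<epsilon> * norm x + \<epsilon> * norm x"
        by (simp add: \<epsilon>_def field_simps)
      ultimately have "\<epsilon> * norm x \<le> norm T * norm (E x)" by linarith
      moreover have "0 < norm T" using T by linarith
      ultimately show ?thesis by (simp add: c_def field_simps)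
    qed
    then obtain Z where Z: "Z \<in> M" "norm Z \<le> norm E / c\<^sup>2" "Z o\<^sub>L (E o\<^sub>L Q) = Q"
      using left_inverse_on_projection[OF EM(1) Q c] by blast
    have "norm Z \<le> 1 / c\<^sup>2"
      using Z(2) divide_right_mono[OF proj_norm_le[OF E(1)], of "c\<^sup>2"] by simp
    then have "tr (adj (Z o\<^sub>L (E o\<^sub>L Q)) o\<^sub>L (Z o\<^sub>L (E o\<^sub>L Q)))
        \<le> (1 / c\<^sup>2)\<^sup>2 * tr (adj (E o\<^sub>L Q) o\<^sub>L (E o\<^sub>L Q))"
      using EM Z(1) c by (intro tr_comp_le) auto
    also have "adj (E o\<^sub>L Q) o\<^sub>L (E o\<^sub>L Q) = Q o\<^sub>L (E o\<^sub>L adj Q)"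
      using EM by (simp add: adj_compose bounded projD(3)[OF E(1)] projD(3)[OF Q] blinfun_eq_iff
          projD(5)[OF E(1)])
    also have "(1 / c\<^sup>2)\<^sup>2 * tr (Q o\<^sub>L (E o\<^sub>L adj Q)) \<le> (1 / c\<^sup>2)\<^sup>2 * tr E"
      by (intro mult_left_mono tr_compression_le proj_norm_le EM Q E) auto
    also have "\<dots> < (1 / c\<^sup>2)\<^sup>2 * \<delta>"
      using E(2) c by (intro mult_strict_left_mono) auto
    also have "\<dots> = tr Q" using c by (simp add: \<delta>_def)
    finally show False
      by (simp add: Z(3) projD(3,4)[OF Q])
  qed
  then show ?thesis using \<epsilon> \<delta> by blast
qed

text \<open>
  On the ball \<open>B\<close>, neighborhoods for \<open>N\<close> and for measure refine each other. A relatively \<open>N\<close>-open set \<open>S\<close> must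
  moreover be the intersection of \<open>B\<close> with an open set of the whole algebra: the complement of \<open>B - S\<close> is one, because
  around points outside \<open>B\<close> there is a measure neighborhood that misses \<open>B\<close> altogether.
\<close>

theorem continuous_topology:
  assumes cont: "continuous_norm M \<tau> N"
  shows "subtopology (norm_topology M N) (op_unit_ball M)
    = subtopology (measure_topology M \<tau>) (op_unit_ball M)"
  unfolding topology_eq
proof (intro allI iffI)
  let ?B = "op_unit_ball M"
  have B: "x \<in> M" "norm x \<le> 1" if "x \<in> ?B" for x
    using that by (auto simp: op_unit_ball_def)
  have norm_diff: "norm (y - x) \<le> 2" if "x \<in> ?B" "y \<in> ?B" for x y
    using norm_triangle_ineq4[of y x] B[OF that(1)] B[OF that(2)] by linarith
  fix S
  {
    assume "openin (subtopology (measure_topology M \<tau>) ?B) S"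
    then obtain U where U: "openin (measure_topology M \<tau>) U" and S: "S = U \<inter> ?B"
      unfolding openin_subtopology by blast
    have "\<exists>r>0. \<forall>y\<in>?B. N (y - x) < r \<longrightarrow> y \<in> S" if x: "x \<in> S" for x
    proof -
      obtain \<epsilon> \<delta> where pos: "0 < \<epsilon>" "0 < \<delta>" and sub: "(+) x ` measure_nbhd M \<tau> \<epsilon> \<delta> \<subseteq> U"
        using U x unfolding openin_measure_topology S by blast
      obtain r where r: "r > 0"
        and small: "\<And>T. T \<in> M \<Longrightarrow> norm T \<le> 2 \<Longrightarrow> N T < r \<Longrightarrow> T \<in> measure_nbhd M \<tau> \<epsilon> \<delta>"
        using measure_nbhd_of_N_small[OF pos] by blast
      have "y \<in> S" if y: "y \<in> ?B" "N (y - x) < r" for y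
      proof -
        have "y - x \<in> measure_nbhd M \<tau> \<epsilon> \<delta>"
          using x y B norm_diff by (intro small) (auto simp: S)
        then have "x + (y - x) \<in> U" using sub by blast
        then show ?thesis using y(1) by (simp add: S)
      qed
      then show ?thesis using r by blast
    qed
    then show "openin (subtopology (norm_topology M N) ?B) S"
      unfolding openin_norm_topology_ball by (auto simp: S)
  next
    assume "openin (subtopology (norm_topology M N) ?B) S"
    then have SB: "S \<subseteq> ?B"
      and S: "\<And>x. x \<in> S \<Longrightarrow> \<exists>r>0. \<forall>y\<in>?B. N (y - x) < r \<longrightarrow> y \<in> S"
      unfolding openin_norm_topology_ball by blast+
    define U where "U = M - (?B - S)"
    have "\<exists>\<epsilon>>0. \<exists>\<delta>>0. (+) x ` measure_nbhd M \<tau> \<epsilon> \<delta> \<subseteq> U" if x: "x \<in> U" for x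
    proof -
      have xM: "x \<in> M" using x by (simp add: U_def)
      have "\<exists>\<epsilon>>0. \<exists>\<delta>>0. \<forall>y\<in>?B. y - x \<in> measure_nbhd M \<tau> \<epsilon> \<delta> \<longrightarrow> y \<in> S"
      proof (cases "x \<in> ?B")
        case True
        then obtain r where r: "r > 0" "\<And>y. y \<in> ?B \<Longrightarrow> N (y - x) < r \<Longrightarrow> y \<in> S"
          using S[of x] x by (auto simp: U_def)
        obtain \<epsilon> \<delta> where "0 < \<epsilon>" "0 < \<delta>"
          and "\<And>T. T \<in> measure_nbhd M \<tau> \<epsilon> \<delta> \<Longrightarrow> norm T \<le> 2 \<Longrightarrow> N T < r"
          using N_small_of_measure_nbhd[OF cont r(1)] by blast
        then show ?thesis
          using r(2) norm_diff[OF True] by meson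
      next
        case False
        then have "1 < norm x" using xM by (simp add: op_unit_ball_def)
        then show ?thesis
          using unit_ball_measure_closed[OF xM] by meson
      qed
      then obtain \<epsilon> \<delta> where pos: "0 < \<epsilon>" "0 < \<delta>"
        and near: "\<And>y. y \<in> ?B \<Longrightarrow> y - x \<in> measure_nbhd M \<tau> \<epsilon> \<delta> \<Longrightarrow> y \<in> S" by blast
      have "x + t \<in> U" if t: "t \<in> measure_nbhd M \<tau> \<epsilon> \<delta>" for t
        using near[of "x + t"] t xM by (auto simp: U_def measure_nbhd_def)
      then show ?thesis using pos by blast
    qed
    then have "openin (measure_topology M \<tau>) U"
      unfolding openin_measure_topology by (auto simp: U_def)
    moreover have "S = U \<inter> ?B"
      using SB B by (auto simp: U_def)
    ultimately show "openin (subtopology (measure_topology M \<tau>) ?B) S"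
      unfolding openin_subtopology by blast
  }
qed

end

theorem theoremG:
  fixes M :: "('h::chilbert_space \<Rightarrow>\<^sub>L 'h) set"
    and \<tau> :: "('h \<Rightarrow>\<^sub>L 'h) \<Rightarrow> complex"
    and N :: "('h \<Rightarrow>\<^sub>L 'h) \<Rightarrow> real"
  assumes "type_II1_factor M"
    and "tracial_state M \<tau>"
    and "unitarily_invariant_norm M N"
  shows "(singular_norm M \<tau> N \<longrightarrow>
            subtopology (norm_topology M N) (op_unit_ball M) = top_of_set (op_unit_ball M))
       \<and> (continuous_norm M \<tau> N \<longrightarrow>
            subtopology (norm_topology M N) (op_unit_ball M)
              = subtopology (measure_topology M \<tau>) (op_unit_ball M))"
proof -
  have factor: "factor M" and vn: "von_neumann_algebra M"
    using assms(1) by (auto simp: type_II1_factor_def factor_def)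
  interpret unitarily_invariant_II1 M \<tau> N
  proof
    show "V o\<^sub>L adj V = id_blinfun" if "V \<in> M" "adj V o\<^sub>L V = id_blinfun" for V
      using assms(1) that unfolding type_II1_factor_def by blast
    show "\<exists>F\<in>projections M. F \<noteq> 0 \<and> F \<noteq> E \<and> E o\<^sub>L F = F" if "E \<in> projections M" "E \<noteq> 0" for E
      using assms(1) that unfolding type_II1_factor_def by blast
  qed (fact vn factor assms(2,3))+
  show ?thesis
    using singular_topology continuous_topology by blast
qed

end
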